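(* Let $X$ be a finite-dimensional complex Kähler manifold with Hermitian metric $h$, and let $LX=W^{k,2}(\mathbb{S}^1,X)$, $k\ge1$, be equipped with the metric $H_g(\xi,\eta)=\int_{\mathbb{S}^1}h_{g(s)}(\xi(s),\eta(s))\,ds$. Let $f,g\in LX$ be two loops and let $\gamma:[0,1]\to LX$ be a path joining them, i.e., writing $\gamma_s(t)=\gamma(t)(s)$, $$\forall s\in\mathbb{S}^1,\quad \gamma_s(0)=f(s)\ \text{ and }\ \gamma_s(1)=g(s).$$ Then $\gamma$ is a geodesic in $LX$ if and only if for all $s\in\mathbb{S}^1$ the path $\gamma_s$ is a geodesic in $X$ joining $f(s)$ and $g(s)$.
   Context: $LX$ is the Sobolev loop space, a complex Hilbert manifold with $T_g(LX)=W^{k,2}(\mathbb{S}^1,g^*TX)$; $ds$ is a fixed rotation-invariant measure on $\mathbb{S}^1$. $\nabla$ is the Levi-Civita connection of $(X,h)$; a path $c$ in $X$ is a geodesic if $\nabla_{\dot c(t)}\dot c(t)=0$. A path $\gamma$ in $LX$ is a geodesic if $\tilde\nabla_{\dot\gamma(t)}\dot\gamma(t)=0$, where $\tilde\nabla$ is the Levi-Civita connection of $(LX,H)$. The paper realizes $\tilde\nabla$ as follows: for $g\in LX$ and a vector field $\xi$ on $LX$ let $\hat\xi$ be the induced vector field on $X$ along $g$, with $\hat\xi(g(s))=\xi_g(s)$ for all $s\in\mathbb{S}^1$; then for vector fields $\xi,\nu$ on $LX$, $\tilde\nabla_\nu\xi(g)=\big(s\mapsto\nabla_{\hat\nu}\hat\xi(g(s))\big)\in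 T_g(LX)$. Paths are smooth enough for the geodesic equations to make sense. *)

theory Defs
  imports "HOL-Analysis.Analysis"
begin

section \<open>Complex manifolds and tangent vectors\<close>

text \<open>The underlying space of the manifold is a whole Hausdorff, second countable type.
  A chart is a pair of an open domain and a coordinate map into \<open>complex^'n\<close>.\<close>

type_synonym ('x, 'n) chart = "'x set \<times> ('x \<Rightarrow> complex ^ 'n)"

definition chart_inv :: "('x, 'n::finite) chart \<Rightarrow> complex ^ 'n \<Rightarrow> 'x" where
  "chart_inv c = inv_into (fst c) (snd c)"

definition transition ::
    "('x, 'n::finite) chart \<Rightarrow> ('x, 'n) chart \<Rightarrow> complex ^ 'n \<Rightarrow> complex ^ 'n" where
  "transition c d = snd d \<circ> chart_inv c"

definition holomorphic_map_on ::
    "(complex ^ 'n::finite \<Rightarrow> complex ^ 'm::finite) \<Rightarrow> (complex ^ 'n) set \<Rightarrow> bool" where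
  "holomorphic_map_on F S \<longleftrightarrow>
     (\<forall>z\<in>S. \<exists>L. (F has_derivative L) (at z) \<and> (\<forall>a v. L (a *s v) = a *s L v))"

definition complex_atlas ::
    "('x::{t2_space, second_countable_topology}, 'n::finite) chart set \<Rightarrow> bool" where
  "complex_atlas A \<longleftrightarrow>
     (\<Union>c\<in>A. fst c) = UNIV \<and>
     (\<forall>c\<in>A. open (fst c) \<and> open (snd c ` fst c) \<and>
            homeomorphism (fst c) (snd c ` fst c) (snd c) (chart_inv c)) \<and>
     (\<forall>c\<in>A. \<forall>d\<in>A. holomorphic_map_on (transition c d) (snd c ` (fst c \<inter> fst d)))"

text \<open>A tangent vector at \<open>p\<close> is the family of its coordinate vectors in all charts around \<open>p\<close>,
  related by the differentials of the transition maps (and \<open>0\<close> at all other arguments, so that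
  equality of tangent vectors is equality of functions).\<close>

type_synonym ('x, 'n) tvec = "('x, 'n) chart \<Rightarrow> complex ^ 'n"

definition chart_at :: "('x, 'n::finite) chart set \<Rightarrow> 'x \<Rightarrow> ('x, 'n) chart \<Rightarrow> bool" where
  "chart_at A p c \<longleftrightarrow> c \<in> A \<and> p \<in> fst c"

definition tangent_space :: "('x, 'n::finite) chart set \<Rightarrow> 'x \<Rightarrow> ('x, 'n) tvec set" where
  "tangent_space A p = {v.
     (\<forall>c. \<not> chart_at A p c \<longrightarrow> v c = 0) \<and>
     (\<forall>c d. chart_at A p c \<longrightarrow> chart_at A p d \<longrightarrow>
        v d = frechet_derivative (transition c d) (at (snd c p)) (v c))}"

text \<open>The tangent vector at \<open>p\<close> with coordinate vector \<open>a\<close> in the chart \<open>c\<close>.\<close>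

definition coord_tvec ::
    "('x, 'n::finite) chart set \<Rightarrow> ('x, 'n) chart \<Rightarrow> 'x \<Rightarrow> complex ^ 'n \<Rightarrow> ('x, 'n) tvec" where
  "coord_tvec A c p a = (\<lambda>d. if chart_at A p d
     then frechet_derivative (transition c d) (at (snd c p)) a else 0)"

section \<open>Kaehler metrics and the Levi-Civita connection\<close>

text \<open>On an open subset of a finite-dimensional space, \<open>f\<close> is of class \<open>C^(m+1)\<close> iff it is
  differentiable and all its directional derivatives are of class \<open>C^m\<close>.\<close>

primrec Ck_on ::
    "nat \<Rightarrow> ('a::euclidean_space \<Rightarrow> 'b::real_normed_vector) \<Rightarrow> 'a set \<Rightarrow> bool" where
  "Ck_on 0 f S \<longleftrightarrow> continuous_on S f"
| "Ck_on (Suc m) f S \<longleftrightarrow> (\<forall>x\<in>S. f differentiable (at x)) \<and>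
     (\<forall>v. Ck_on m (\<lambda>x. frechet_derivative f (at x) v) S)"

definition Cinfinity_on ::
    "('a::euclidean_space \<Rightarrow> 'b::real_normed_vector) \<Rightarrow> 'a set \<Rightarrow> bool" where
  "Cinfinity_on f S \<longleftrightarrow> (\<forall>m. Ck_on m f S)"

type_synonym ('x, 'n) tmetric = "'x \<Rightarrow> ('x, 'n) tvec \<Rightarrow> ('x, 'n) tvec \<Rightarrow> complex"

definition local_metric ::
    "('x, 'n::finite) chart set \<Rightarrow> ('x, 'n) tmetric \<Rightarrow> ('x, 'n) chart \<Rightarrow>
     complex ^ 'n \<Rightarrow> complex ^ 'n \<Rightarrow> complex ^ 'n \<Rightarrow> complex" where
  "local_metric A h c x a b =
     h (chart_inv c x) (coord_tvec A c (chart_inv c x) a) (coord_tvec A c (chart_inv c x) b)"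

text \<open>Convention: \<open>h\<close> is linear in the first and antilinear in the second argument.\<close>

definition hermitian_metric ::
    "('x, 'n::finite) chart set \<Rightarrow> ('x, 'n) tmetric \<Rightarrow> bool" where
  "hermitian_metric A h \<longleftrightarrow>
     (\<forall>p. \<forall>u\<in>tangent_space A p. \<forall>v\<in>tangent_space A p. \<forall>w\<in>tangent_space A p.
        h p (\<lambda>c. u c + v c) w = h p u w + h p v w \<and>
        (\<forall>z. h p (\<lambda>c. z *s u c) w = z * h p u w) \<and>
        h p v u = cnj (h p u v)) \<and>
     (\<forall>p. \<forall>u\<in>tangent_space A p. u \<noteq> (\<lambda>c. 0) \<longrightarrow> Re (h p u u) > 0) \<and>
     (\<forall>c\<in>A. \<forall>a b. Cinfinity_on (\<lambda>x. local_metric A h c x a b) (snd c ` fst c))"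

text \<open>The fundamental form \<open>\<omega>(a,b) = Re (h (\<i>a, b)) = - Im (h (a, b))\<close> in a chart; it is closed
  iff the cyclic sum of its derivatives along constant coordinate vector fields vanishes.\<close>

definition local_kaehler_form ::
    "('x, 'n::finite) chart set \<Rightarrow> ('x, 'n) tmetric \<Rightarrow> ('x, 'n) chart \<Rightarrow>
     complex ^ 'n \<Rightarrow> complex ^ 'n \<Rightarrow> complex ^ 'n \<Rightarrow> real" where
  "local_kaehler_form A h c x a b = - Im (local_metric A h c x a b)"

definition kaehler_form_closed ::
    "('x, 'n::finite) chart set \<Rightarrow> ('x, 'n) tmetric \<Rightarrow> bool" where
  "kaehler_form_closed A h \<longleftrightarrow>
     (\<forall>c\<in>A. \<forall>x\<in>snd c ` fst c. \<forall>u v w.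
        frechet_derivative (\<lambda>y. local_kaehler_form A h c y v w) (at x) u +
        frechet_derivative (\<lambda>y. local_kaehler_form A h c y w u) (at x) v +
        frechet_derivative (\<lambda>y. local_kaehler_form A h c y u v) (at x) w = 0)"

definition kaehler_manifold ::
    "('x::{t2_space, second_countable_topology}, 'n::finite) chart set \<Rightarrow>
     ('x, 'n) tmetric \<Rightarrow> bool" where
  "kaehler_manifold A h \<longleftrightarrow> complex_atlas A \<and> hermitian_metric A h \<and> kaehler_form_closed A h"

text \<open>A connection is given by its Christoffel maps: in the chart \<open>c\<close>,
  \<open>\<nabla>_V W = DW(V) + \<Gamma> c x V W\<close>, with \<open>\<Gamma> c x\<close> real bilinear. In these terms vanishing torsion is the
  symmetry of \<open>\<Gamma> c x\<close>, and compatibility is required with the Riemannian metric \<open>Re h\<close>. The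
  transformation behaviour of \<open>\<Gamma>\<close> under change of charts and its smoothness are consequences.\<close>

type_synonym ('x, 'n) christoffel =
  "('x, 'n) chart \<Rightarrow> complex ^ 'n \<Rightarrow> complex ^ 'n \<Rightarrow> complex ^ 'n \<Rightarrow> complex ^ 'n"

definition levi_civita ::
    "('x, 'n::finite) chart set \<Rightarrow> ('x, 'n) tmetric \<Rightarrow> ('x, 'n) christoffel \<Rightarrow> bool" where
  "levi_civita A h \<Gamma> \<longleftrightarrow>
     (\<forall>c\<in>A. \<forall>x\<in>snd c ` fst c.
        bilinear (\<Gamma> c x) \<and>
        (\<forall>a b. \<Gamma> c x a b = \<Gamma> c x b a) \<and>
        (\<forall>u a b. frechet_derivative (\<lambda>y. Re (local_metric A h c y a b)) (at x) u =
           Re (local_metric A h c x (\<Gamma> c x u a) b) + Re (local_metric A h c x a (\<Gamma> c x u b))))"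

section \<open>Curves and geodesics in the manifold\<close>

definition nondegenerate_interval :: "real set \<Rightarrow> bool" where
  "nondegenerate_interval I \<longleftrightarrow> is_interval I \<and> (\<exists>a\<in>I. \<exists>b\<in>I. a < b)"

primrec curve_Ck :: "nat \<Rightarrow> (real \<Rightarrow> 'e::real_normed_vector) \<Rightarrow> real set \<Rightarrow> bool" where
  "curve_Ck 0 u S \<longleftrightarrow> continuous_on S u"
| "curve_Ck (Suc m) u S \<longleftrightarrow>
     (\<exists>u'. (\<forall>t\<in>S. (u has_vector_derivative u' t) (at t within S)) \<and> curve_Ck m u' S)"

definition smooth_curve ::
    "nat \<Rightarrow> ('x, 'n::finite) chart set \<Rightarrow> real set \<Rightarrow> (real \<Rightarrow> 'x) \<Rightarrow> bool" where
  "smooth_curve m A I \<gamma> \<longleftrightarrow>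
     (\<forall>t\<in>I. \<exists>c\<in>A. \<exists>\<delta>>0. (\<forall>r\<in>I \<inter> ball t \<delta>. \<gamma> r \<in> fst c) \<and>
        curve_Ck m (\<lambda>r. snd c (\<gamma> r)) (I \<inter> ball t \<delta>))"

definition velocity ::
    "('x, 'n::finite) chart set \<Rightarrow> real set \<Rightarrow> (real \<Rightarrow> 'x) \<Rightarrow> real \<Rightarrow> ('x, 'n) tvec" where
  "velocity A I \<gamma> t = (\<lambda>c. if chart_at A (\<gamma> t) c
     then vector_derivative (\<lambda>r. snd c (\<gamma> r)) (at t within I) else 0)"

text \<open>The covariant derivative at \<open>t\<close> of a vector field \<open>V\<close> along \<open>\<gamma>\<close>.\<close>

definition covariant_derivative ::
    "('x, 'n::finite) chart set \<Rightarrow> ('x, 'n) christoffel \<Rightarrow> real set \<Rightarrow> (real \<Rightarrow> 'x) \<Rightarrow>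
     (real \<Rightarrow> ('x, 'n) tvec) \<Rightarrow> real \<Rightarrow> ('x, 'n) tvec" where
  "covariant_derivative A \<Gamma> I \<gamma> V t = (\<lambda>c. if chart_at A (\<gamma> t) c
     then vector_derivative (\<lambda>r. V r c) (at t within I)
          + \<Gamma> c (snd c (\<gamma> t)) (velocity A I \<gamma> t c) (V t c)
     else 0)"

definition geodesic ::
    "('x, 'n::finite) chart set \<Rightarrow> ('x, 'n) christoffel \<Rightarrow> real set \<Rightarrow> (real \<Rightarrow> 'x) \<Rightarrow> bool" where
  "geodesic A \<Gamma> I \<gamma> \<longleftrightarrow> smooth_curve 2 A I \<gamma> \<and>
     (\<forall>t\<in>I. covariant_derivative A \<Gamma> I \<gamma> (velocity A I \<gamma>) t = (\<lambda>c. 0))"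

section \<open>The Sobolev spaces W^(k,2) of a compact interval\<close>

definition test_function :: "real \<Rightarrow> real \<Rightarrow> (real \<Rightarrow> real) \<Rightarrow> bool" where
  "test_function a b \<phi> \<longleftrightarrow>
     (\<forall>m x. (deriv ^^ m) \<phi> differentiable (at x)) \<and>
     (\<exists>a' b'. a < a' \<and> b' < b \<and> (\<forall>x. x \<notin> {a'..b'} \<longrightarrow> \<phi> x = 0))"

definition square_integrable_on ::
    "(real \<Rightarrow> 'e::euclidean_space) \<Rightarrow> real \<Rightarrow> real \<Rightarrow> bool" where
  "square_integrable_on u a b \<longleftrightarrow> set_borel_measurable lborel {a..b} u \<and>
     set_integrable lborel {a..b} (\<lambda>x. (norm (u x))\<^sup>2)"

definition has_weak_derivative ::
    "nat \<Rightarrow> real \<Rightarrow> real \<Rightarrow> (real \<Rightarrow> 'e::euclidean_space) \<Rightarrow> (real \<Rightarrow> 'e) \<Rightarrow> bool" where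
  "has_weak_derivative j a b u v \<longleftrightarrow>
     (\<forall>\<phi>. test_function a b \<phi> \<longrightarrow>
        (LINT x:{a..b}|lborel. (deriv ^^ j) \<phi> x *\<^sub>R u x) =
        (-1) ^ j *\<^sub>R (LINT x:{a..b}|lborel. \<phi> x *\<^sub>R v x))"

text \<open>As \<open>k \<ge> 1\<close>, every class in \<open>W^(k,2)\<close> of an interval has exactly one continuous
  representative, and \<open>u\<close> is required to be it.\<close>

definition sobolev ::
    "nat \<Rightarrow> real \<Rightarrow> real \<Rightarrow> (real \<Rightarrow> 'e::euclidean_space) \<Rightarrow> bool" where
  "sobolev k a b u \<longleftrightarrow> continuous_on {a..b} u \<and>
     (\<forall>j\<le>k. \<exists>v. square_integrable_on v a b \<and> has_weak_derivative j a b u v)"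

definition weak_derivative ::
    "nat \<Rightarrow> real \<Rightarrow> real \<Rightarrow> (real \<Rightarrow> 'e::euclidean_space) \<Rightarrow> real \<Rightarrow> 'e" where
  "weak_derivative j a b u = (SOME v. square_integrable_on v a b \<and> has_weak_derivative j a b u v)"

definition sobolev_norm ::
    "nat \<Rightarrow> real \<Rightarrow> real \<Rightarrow> (real \<Rightarrow> 'e::euclidean_space) \<Rightarrow> real" where
  "sobolev_norm k a b u =
     sqrt ((LINT x:{a..b}|lborel. (norm (u x))\<^sup>2) +
           (\<Sum>j=1..k. LINT x:{a..b}|lborel. (norm (weak_derivative j a b u x))\<^sup>2))"

text \<open>Frechet derivative and classes \<open>C^m\<close> for maps \<open>p \<mapsto> u p\<close> into the Hilbert space
  \<open>W^(k,2)\<close> of \<open>{a..b}\<close>, with respect to its norm. Elements of this space are functions restricted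
  to \<open>{a..b}\<close>, so linearity is only required there.\<close>

definition sobolev_has_derivative ::
    "nat \<Rightarrow> real \<Rightarrow> real \<Rightarrow> ('d::euclidean_space \<Rightarrow> real \<Rightarrow> 'e::euclidean_space) \<Rightarrow>
     ('d \<Rightarrow> real \<Rightarrow> 'e) \<Rightarrow> 'd \<Rightarrow> 'd set \<Rightarrow> bool" where
  "sobolev_has_derivative k a b u L p S \<longleftrightarrow>
     (\<forall>v. sobolev k a b (L v)) \<and>
     (\<forall>v w z. \<forall>x\<in>{a..b}. L (v + z *\<^sub>R w) x = L v x + z *\<^sub>R L w x) \<and>
     ((\<lambda>q. sobolev_norm k a b (\<lambda>x. u q x - u p x - L (q - p) x) / norm (q - p)) \<longlongrightarrow> 0)
       (at p within S)"

primrec sobolev_Ck ::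
    "nat \<Rightarrow> nat \<Rightarrow> real \<Rightarrow> real \<Rightarrow> ('d::euclidean_space \<Rightarrow> real \<Rightarrow> 'e::euclidean_space) \<Rightarrow>
     'd set \<Rightarrow> bool" where
  "sobolev_Ck 0 k a b u S \<longleftrightarrow> (\<forall>p\<in>S. sobolev k a b (u p) \<and>
     ((\<lambda>q. sobolev_norm k a b (\<lambda>x. u q x - u p x)) \<longlongrightarrow> 0) (at p within S))"
| "sobolev_Ck (Suc m) k a b u S \<longleftrightarrow> (\<forall>p\<in>S. sobolev k a b (u p)) \<and>
     (\<exists>u'. (\<forall>p\<in>S. sobolev_has_derivative k a b u (u' p) p S) \<and>
           (\<forall>v. sobolev_Ck m k a b (\<lambda>p. u' p v) S))"

section \<open>The Sobolev loop space\<close>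

text \<open>The circle is the unit circle of the complex plane, with arcs parametrized by \<open>cis\<close>.\<close>

abbreviation S1 :: "complex set" where
  "S1 \<equiv> sphere 0 1"

definition arc_in_chart ::
    "('x, 'n::finite) chart \<Rightarrow> real \<Rightarrow> real \<Rightarrow> (complex \<Rightarrow> 'x) \<Rightarrow> bool" where
  "arc_in_chart c a b g \<longleftrightarrow> (\<forall>x\<in>{a..b}. g (cis x) \<in> fst c)"

definition loop_space ::
    "nat \<Rightarrow> ('x::topological_space, 'n::finite) chart set \<Rightarrow> (complex \<Rightarrow> 'x) set" where
  "loop_space k A = {g. g \<in> extensional S1 \<and> continuous_on S1 g \<and>
     (\<forall>\<theta>. \<exists>c\<in>A. \<exists>a b. a < \<theta> \<and> \<theta> < b \<and> arc_in_chart c a b g \<and>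
        sobolev k a b (\<lambda>x. snd c (g (cis x))))}"

text \<open>\<open>T_g(LX)\<close>: the \<open>W^(k,2)\<close> vector fields along \<open>g\<close>, with value \<open>0\<close> off the circle.\<close>

definition tangent_loops ::
    "nat \<Rightarrow> ('x, 'n::finite) chart set \<Rightarrow> (complex \<Rightarrow> 'x) \<Rightarrow> (complex \<Rightarrow> ('x, 'n) tvec) set" where
  "tangent_loops k A g = {\<xi>.
     (\<forall>s\<in>S1. \<xi> s \<in> tangent_space A (g s)) \<and> (\<forall>s. s \<notin> S1 \<longrightarrow> \<xi> s = (\<lambda>c. 0)) \<and>
     (\<forall>\<theta>. \<exists>c\<in>A. \<exists>a b. a < \<theta> \<and> \<theta> < b \<and> arc_in_chart c a b g \<and>
        sobolev k a b (\<lambda>x. \<xi> (cis x) c))}"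

text \<open>The manifold structure of \<open>LX\<close> is the one for which finitely many restrictions to closed
  arcs covering the circle, composed with charts of \<open>X\<close> around the images of these arcs, embed an
  open set of loops into the product of the Hilbert spaces \<open>W^(k,2)\<close> of the arcs. Hence a map into
  \<open>LX\<close> is of class \<open>C^m\<close> iff, locally, its composition with these restrictions is.\<close>

definition loop_smooth ::
    "nat \<Rightarrow> nat \<Rightarrow> ('x::topological_space, 'n::finite) chart set \<Rightarrow> 'd::euclidean_space set \<Rightarrow>
     ('d \<Rightarrow> complex \<Rightarrow> 'x) \<Rightarrow> bool" where
  "loop_smooth m k A S F \<longleftrightarrow> (\<forall>p\<in>S. F p \<in> loop_space k A) \<and>
     (\<forall>p\<in>S. \<forall>\<theta>. \<exists>c\<in>A. \<exists>a b. \<exists>\<delta>>0. a < \<theta> \<and> \<theta> < b \<and>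
        (\<forall>q\<in>S \<inter> ball p \<delta>. arc_in_chart c a b (F q)) \<and>
        sobolev_Ck m k a b (\<lambda>q x. snd c (F q (cis x))) (S \<inter> ball p \<delta>))"

text \<open>\<open>C^m\<close> vector fields along a path in \<open>LX\<close>.\<close>

definition loop_field ::
    "nat \<Rightarrow> nat \<Rightarrow> ('x, 'n::finite) chart set \<Rightarrow> real set \<Rightarrow> (real \<Rightarrow> complex \<Rightarrow> 'x) \<Rightarrow>
     (real \<Rightarrow> complex \<Rightarrow> ('x, 'n) tvec) \<Rightarrow> bool" where
  "loop_field m k A I \<gamma> \<xi> \<longleftrightarrow> (\<forall>t\<in>I. \<xi> t \<in> tangent_loops k A (\<gamma> t)) \<and>
     (\<forall>t\<in>I. \<forall>\<theta>. \<exists>c\<in>A. \<exists>a b. \<exists>\<delta>>0. a < \<theta> \<and> \<theta> < b \<and>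
        (\<forall>r\<in>I \<inter> ball t \<delta>. arc_in_chart c a b (\<gamma> r)) \<and>
        sobolev_Ck m k a b (\<lambda>r x. \<xi> r (cis x) c) (I \<inter> ball t \<delta>))"

text \<open>The velocity of a path in \<open>LX\<close> is its derivative in the manifold \<open>LX\<close>, i.e. with respect
  to the \<open>W^(k,2)\<close> norms on arcs, and not merely pointwise on the circle.\<close>

definition has_loop_velocity ::
    "nat \<Rightarrow> ('x, 'n::finite) chart set \<Rightarrow> real set \<Rightarrow> (real \<Rightarrow> complex \<Rightarrow> 'x) \<Rightarrow> real \<Rightarrow>
     (complex \<Rightarrow> ('x, 'n) tvec) \<Rightarrow> bool" where
  "has_loop_velocity k A I \<gamma> t \<xi> \<longleftrightarrow> \<xi> \<in> tangent_loops k A (\<gamma> t) \<and>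
     (\<forall>\<theta>. \<exists>c\<in>A. \<exists>a b. \<exists>\<delta>>0. a < \<theta> \<and> \<theta> < b \<and>
        (\<forall>r\<in>I \<inter> ball t \<delta>. arc_in_chart c a b (\<gamma> r)) \<and>
        sobolev_has_derivative k a b (\<lambda>r x. snd c (\<gamma> r (cis x)))
          (\<lambda>v x. v *\<^sub>R \<xi> (cis x) c) t (I \<inter> ball t \<delta>))"

definition loop_velocity ::
    "nat \<Rightarrow> ('x, 'n::finite) chart set \<Rightarrow> real set \<Rightarrow> (real \<Rightarrow> complex \<Rightarrow> 'x) \<Rightarrow> real \<Rightarrow>
     complex \<Rightarrow> ('x, 'n) tvec" where
  "loop_velocity k A I \<gamma> t = (THE \<xi>. has_loop_velocity k A I \<gamma> t \<xi>)"

section \<open>The metric of the loop space, its Levi-Civita connection and its geodesics\<close>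

definition rotation_invariant :: "complex measure \<Rightarrow> bool" where
  "rotation_invariant ds \<longleftrightarrow> sets ds = sets (restrict_space borel S1) \<and> finite_measure ds \<and>
     emeasure ds S1 \<noteq> 0 \<and>
     (\<forall>z\<in>S1. \<forall>E\<in>sets ds. emeasure ds ((\<lambda>s. z * s) ` E) = emeasure ds E)"

type_synonym ('x, 'n) loop_tmetric =
  "(complex \<Rightarrow> 'x) \<Rightarrow> (complex \<Rightarrow> ('x, 'n) tvec) \<Rightarrow> (complex \<Rightarrow> ('x, 'n) tvec) \<Rightarrow> complex"

definition loop_metric ::
    "('x, 'n::finite) tmetric \<Rightarrow> complex measure \<Rightarrow> ('x, 'n) loop_tmetric" where
  "loop_metric h ds g \<xi> \<eta> = (LINT s|ds. h (g s) (\<xi> s) (\<eta> s))"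

text \<open>A connection on \<open>LX\<close> is given by its covariant derivative along paths:
  \<open>N I \<gamma> \<xi> t\<close> is the covariant derivative at \<open>t\<close> of the vector field \<open>\<xi>\<close> along
  \<open>\<gamma>\<close>, a path defined on the interval \<open>I\<close>. (For a vector field \<open>\<Xi>\<close> on \<open>LX\<close> and \<open>\<gamma>\<close> with
  \<open>\<gamma> t = g\<close> and velocity \<open>\<nu>\<close> at \<open>t\<close>, the value of \<open>N I \<gamma> (\<Xi> \<circ> \<gamma>) t\<close> is the
  derivative of \<open>\<Xi>\<close> at \<open>g\<close> in the direction \<open>\<nu>\<close>.)\<close>

type_synonym ('x, 'n) loop_connection =
  "real set \<Rightarrow> (real \<Rightarrow> complex \<Rightarrow> 'x) \<Rightarrow> (real \<Rightarrow> complex \<Rightarrow> ('x, 'n) tvec) \<Rightarrow> real \<Rightarrow>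
   complex \<Rightarrow> ('x, 'n) tvec"

definition loop_covariant_derivative ::
    "nat \<Rightarrow> ('x::topological_space, 'n::finite) chart set \<Rightarrow> ('x, 'n) loop_connection \<Rightarrow> bool" where
  "loop_covariant_derivative k A N \<longleftrightarrow>
     (\<forall>I \<gamma>. nondegenerate_interval I \<longrightarrow> loop_smooth 1 k A I \<gamma> \<longrightarrow>
        (\<forall>\<xi>. loop_field 1 k A I \<gamma> \<xi> \<longrightarrow> (\<forall>t\<in>I. N I \<gamma> \<xi> t \<in> tangent_loops k A (\<gamma> t))) \<and>
        (\<forall>\<xi> \<eta>. loop_field 1 k A I \<gamma> \<xi> \<longrightarrow> loop_field 1 k A I \<gamma> \<eta> \<longrightarrow>
           (\<forall>t\<in>I. N I \<gamma> (\<lambda>r s c. \<xi> r s c + \<eta> r s c) t =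
                  (\<lambda>s c. N I \<gamma> \<xi> t s c + N I \<gamma> \<eta> t s c))) \<and>
        (\<forall>\<xi> f f'. loop_field 1 k A I \<gamma> \<xi> \<longrightarrow> continuous_on I f' \<longrightarrow>
           (\<forall>t\<in>I. (f has_real_derivative f' t) (at t within I)) \<longrightarrow>
           (\<forall>t\<in>I. N I \<gamma> (\<lambda>r s c. f r *\<^sub>R \<xi> r s c) t =
                  (\<lambda>s c. f' t *\<^sub>R \<xi> t s c + f t *\<^sub>R N I \<gamma> \<xi> t s c))))"

definition loop_metric_compatible ::
    "nat \<Rightarrow> ('x::topological_space, 'n::finite) chart set \<Rightarrow> ('x, 'n) loop_tmetric \<Rightarrow>
     ('x, 'n) loop_connection \<Rightarrow> bool" where
  "loop_metric_compatible k A H N \<longleftrightarrow>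
     (\<forall>I \<gamma> \<xi> \<eta>. nondegenerate_interval I \<longrightarrow> loop_smooth 1 k A I \<gamma> \<longrightarrow>
        loop_field 1 k A I \<gamma> \<xi> \<longrightarrow> loop_field 1 k A I \<gamma> \<eta> \<longrightarrow>
        (\<forall>t\<in>I. ((\<lambda>r. Re (H (\<gamma> r) (\<xi> r) (\<eta> r))) has_real_derivative
            Re (H (\<gamma> t) (N I \<gamma> \<xi> t) (\<eta> t)) + Re (H (\<gamma> t) (\<xi> t) (N I \<gamma> \<eta> t))) (at t within I)))"

text \<open>Vanishing torsion: for two-parameter maps \<open>\<sigma>\<close> into \<open>LX\<close>,
  \<open>D/dr (\<partial>\<sigma>/\<partial>q) = D/dq (\<partial>\<sigma>/\<partial>r)\<close>.\<close>

definition loop_torsion_free ::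
    "nat \<Rightarrow> ('x::topological_space, 'n::finite) chart set \<Rightarrow> ('x, 'n) loop_connection \<Rightarrow> bool" where
  "loop_torsion_free k A N \<longleftrightarrow>
     (\<forall>I J \<sigma>. nondegenerate_interval I \<longrightarrow> nondegenerate_interval J \<longrightarrow>
        loop_smooth 2 k A (I \<times> J) \<sigma> \<longrightarrow>
        (\<forall>a\<in>I. \<forall>b\<in>J.
           N I (\<lambda>r. \<sigma> (r, b)) (\<lambda>r. loop_velocity k A J (\<lambda>q. \<sigma> (r, q)) b) a =
           N J (\<lambda>q. \<sigma> (a, q)) (\<lambda>q. loop_velocity k A I (\<lambda>r. \<sigma> (r, q)) a) b))"

definition loop_levi_civita ::
    "nat \<Rightarrow> ('x::topological_space, 'n::finite) chart set \<Rightarrow> ('x, 'n) loop_tmetric \<Rightarrow>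
     ('x, 'n) loop_connection \<Rightarrow> bool" where
  "loop_levi_civita k A H N \<longleftrightarrow> loop_covariant_derivative k A N \<and>
     loop_metric_compatible k A H N \<and> loop_torsion_free k A N"

text \<open>The realization of the Levi-Civita connection of \<open>LX\<close> by that of \<open>X\<close>: for each \<open>s\<close> in the
  circle, \<open>r \<mapsto> \<xi> r s\<close> is the vector field on \<open>X\<close> along \<open>r \<mapsto> \<gamma> r s\<close> induced by \<open>\<xi>\<close>, and it is
  differentiated covariantly in \<open>X\<close>.\<close>

definition realized_by ::
    "nat \<Rightarrow> ('x::topological_space, 'n::finite) chart set \<Rightarrow> ('x, 'n) christoffel \<Rightarrow>
     ('x, 'n) loop_connection \<Rightarrow> bool" where
  "realized_by k A \<Gamma> N \<longleftrightarrow>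
     (\<forall>I \<gamma> \<xi>. nondegenerate_interval I \<longrightarrow> loop_smooth 1 k A I \<gamma> \<longrightarrow> loop_field 1 k A I \<gamma> \<xi> \<longrightarrow>
        (\<forall>t\<in>I. \<forall>s\<in>S1. N I \<gamma> \<xi> t s =
           covariant_derivative A \<Gamma> I (\<lambda>r. \<gamma> r s) (\<lambda>r. \<xi> r s) t))"

definition loop_geodesic ::
    "nat \<Rightarrow> ('x::topological_space, 'n::finite) chart set \<Rightarrow> ('x, 'n) loop_connection \<Rightarrow> real set \<Rightarrow>
     (real \<Rightarrow> complex \<Rightarrow> 'x) \<Rightarrow> bool" where
  "loop_geodesic k A N I \<gamma> \<longleftrightarrow> loop_smooth 2 k A I \<gamma> \<and>
     (\<forall>t\<in>I. N I \<gamma> (loop_velocity k A I \<gamma>) t = (\<lambda>s c. 0))"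

end

theory Submission
  imports Defs "HOL-Complex_Analysis.Cauchy_Integral_Formula" "HOL-Real_Asymp.Real_Asymp"
begin

text \<open>Since \<open>\<nabla>\<close> acts on \<open>LX\<close> pointwise along the circle, the geodesic equation in \<open>LX\<close> is the
  family of geodesic equations of the curves \<open>t \<mapsto> \<gamma> t s\<close>, as soon as the velocity of \<open>\<gamma>\<close> in
  \<open>LX\<close> is the pointwise one and is a \<open>C\<^sup>1\<close> field along \<open>\<gamma>\<close>. For \<open>k \<ge> 1\<close> the \<open>W\<close>-norm dominates the
  supremum norm, so \<open>W\<close>-derivatives are pointwise derivatives; conversely, the transition maps
  being holomorphic have continuous differentials, which makes the pointwise velocity the only
  candidate for the velocity in \<open>LX\<close>, whatever charts are used to test it.\<close>

section \<open>Test functions and the Sobolev embedding\<close>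

text \<open>Nothing about \<open>loop_velocity\<close> is available by construction: it is a
  definite description, and the norm in which it is a derivative is built from weak derivatives
  picked by choice. Smoothed indicators of intervals unlock both difficulties. Testing with a single
  one bounds the oscillation of a function by the integral of the norm of its weak derivative; this
  is what puts the supremum norm below the Sobolev norm. Letting their flanks shrink shows that a
  weak derivative is determined almost everywhere, so the chosen derivatives of a linear combination
  can be compared with those of its terms. The resulting norm estimate gives continuity from
  differentiability and so turns \<open>C^2\<close> paths into \<open>C^1\<close> paths, the class
  for which \<open>realized_by\<close> speaks. The remaining obstacle is that
  \<open>has_loop_velocity\<close> lets the charts depend on the candidate field, so uniqueness has
  to compare derivatives taken in two different charts. Fields are functions on the whole plane; off
  the circle the equation holds because \<open>N\<close> takes values in
  \<open>tangent_loops\<close>.\<close>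

definition flat :: "nat \<Rightarrow> real \<Rightarrow> real" where
  "flat m x = (if x > 0 then exp (- (1 / x)) / x ^ m else 0)"

text \<open>The powers of \<open>1 / x\<close> make the family closed under differentiation up to
  linear combinations: the exponential contributes \<open>1 / x^2\<close>, the power contributes
  \<open>- m / x\<close>. At 0 the right difference quotient tends to 0 because the exponential
  beats every power.\<close>

lemma has_real_derivative_flat:
  "(flat m has_real_derivative flat (m + 2) x - of_nat m * flat (m + 1) x) (at x)"
proof -
  consider "x > 0" | "x < 0" | "x = 0" by linarith
  then show ?thesis
  proof cases
    case 1
    have "((\<lambda>x. exp (- (1 / x)) / x ^ m) has_real_derivative
        flat (m + 2) x - of_nat m * flat (m + 1) x) (at x)"
      using 1 unfolding flat_def
      apply (auto intro!: derivative_eq_intros)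
      apply (cases m)
       apply (auto simp: field_simps power2_eq_square)
      done
    then show ?thesis
      by (rule has_field_derivative_transform_within_open[where S = "{0<..}"])
        (use 1 in \<open>auto simp: flat_def\<close>)
  next
    case 2
    have "((\<lambda>x. 0) has_real_derivative 0) (at x)" by simp
    then have "(flat m has_real_derivative 0) (at x)"
      by (rule has_field_derivative_transform_within_open[where S = "{..<0}"])
        (use 2 in \<open>auto simp: flat_def\<close>)
    then show ?thesis using 2 by (simp add: flat_def)
  next
    case 3
    have "((\<lambda>h::real. exp (- (1 / h)) / h ^ m / h) \<longlongrightarrow> 0) (at_right 0)"
      by real_asymp
    then have "((\<lambda>h. flat m h / h) \<longlongrightarrow> 0) (at_right 0)"
      by (rule Lim_transform_eventually)
        (auto simp: eventually_at_filter flat_def)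
    moreover have "((\<lambda>h. flat m h / h) \<longlongrightarrow> 0) (at_left 0)"
      by (rule Lim_transform_eventually[OF tendsto_const])
        (auto simp: eventually_at_filter flat_def)
    ultimately have "((\<lambda>h. flat m h / h) \<longlongrightarrow> 0) (at 0)"
      by (rule filterlim_split_at[rotated])
    then show ?thesis using 3 by (simp add: DERIV_def flat_def)
  qed
qed

text \<open>This span is closed under differentiation, which makes all its elements smooth.\<close>

inductive flat_span :: "(real \<Rightarrow> real) \<Rightarrow> bool" where
  flat_span_mult: "flat_span (\<lambda>x. flat i (x - c) * flat j (d - x))"
| flat_span_lincomb: "flat_span f \<Longrightarrow> flat_span g \<Longrightarrow> flat_span (\<lambda>x. y * f x + z * g x)"

lemma flat_span_derivative:
  assumes "flat_span f"
  shows "\<exists>f'. flat_span f' \<and> (\<forall>x. (f has_real_derivative f' x) (at x))"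
  using assms
proof induction
  case (flat_span_mult i c j d)
  let ?F = "\<lambda>p q x. flat p (x - c) * flat q (d - x)"
  \<comment> \<open>The product rule gives four terms; they are nested in pairs with explicit
    coefficients so that the expression matches the binary rule
    \<open>flat_span_lincomb\<close>.\<close>
  let ?G = "\<lambda>x. 1 * (1 * ?F (i + 2) j x + (- of_nat i) * ?F (i + 1) j x)
    + 1 * ((-1) * ?F i (j + 2) x + of_nat j * ?F i (j + 1) x)"
  have "flat_span ?G"
    by (intro flat_span.intros)
  moreover have "(?F i j has_real_derivative ?G x) (at x)" for x
  proof -
    have 1: "((\<lambda>x. flat i (x - c)) has_real_derivative
        (flat (i + 2) (x - c) - of_nat i * flat (i + 1) (x - c)) * 1) (at x)"
      by (rule DERIV_chain2[OF has_real_derivative_flat]) (auto intro!: derivative_eq_intros)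
    have 2: "((\<lambda>x. flat j (d - x)) has_real_derivative
        (flat (j + 2) (d - x) - of_nat j * flat (j + 1) (d - x)) * (-1)) (at x)"
      by (rule DERIV_chain2[OF has_real_derivative_flat]) (auto intro!: derivative_eq_intros)
    show ?thesis
      by (rule DERIV_cong[OF DERIV_mult[OF 1 2]]) (simp add: algebra_simps)
  qed
  ultimately show ?case by blast
next
  case (flat_span_lincomb f g y z)
  then obtain f' g' where "flat_span f'" "flat_span g'"
    and "\<forall>x. (f has_real_derivative f' x) (at x)" "\<forall>x. (g has_real_derivative g' x) (at x)"
    by blast
  then show ?case
    by (intro exI[of _ "\<lambda>x. y * f' x + z * g' x"])
      (auto intro!: flat_span.intros derivative_eq_intros)
qed

lemma flat_span_deriv: "flat_span f \<Longrightarrow> flat_span (deriv f)"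
proof -
  assume "flat_span f"
  then obtain f' where f': "flat_span f'" "\<forall>x. (f has_real_derivative f' x) (at x)"
    using flat_span_derivative by blast
  then have "deriv f = f'" by (auto intro: DERIV_imp_deriv)
  with f' show ?thesis by simp
qed

lemma flat_span_funpow_deriv: "flat_span f \<Longrightarrow> flat_span ((deriv ^^ m) f)"
  by (induction m) (auto intro: flat_span_deriv)

lemma flat_span_differentiable: "flat_span f \<Longrightarrow> f differentiable (at x)"
  using flat_span_derivative real_differentiable_def by blast

text \<open>The bump is \<open>exp (- 1 / x) * exp (- 1 / (e - x))\<close> on the interval, divided
  by its integral. Its primitive \<open>G\<close> is a smooth step from 0 to 1; differences of
  translated steps will be the plateau functions used for testing.\<close>

lemma bump_exists:
  assumes "0 < (e::real)"
  obtains \<beta> G :: "real \<Rightarrow> real" where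
    "\<And>c. flat_span (\<lambda>x. \<beta> (x - c))" "\<And>x. 0 \<le> \<beta> x" "\<And>x. x \<notin> {0..e} \<Longrightarrow> \<beta> x = 0"
    "\<And>x. (G has_real_derivative \<beta> x) (at x)"
    "\<And>x. x \<le> 0 \<Longrightarrow> G x = 0" "\<And>x. x \<ge> e \<Longrightarrow> G x = 1" "mono G"
proof -
  define b where "b = (\<lambda>x. flat 0 x * flat 0 (e - x))"
  have b0: "b x \<ge> 0" for x by (auto simp: b_def flat_def)
  have bz: "b x = 0" if "x \<notin> {0<..<e}" for x using that by (auto simp: b_def flat_def)
  have bpos: "b x > 0" if "x \<in> {0<..<e}" for x using that by (auto simp: b_def flat_def)
  have bspan: "flat_span (\<lambda>x. b (x - c))" for c
  proof -
    have "(\<lambda>x. b (x - c)) = (\<lambda>x. flat 0 (x - c) * flat 0 ((e + c) - x))"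
      by (auto simp: b_def algebra_simps)
    then show ?thesis using flat_span_mult by metis
  qed
  have bcont: "continuous_on S b" for S
    using bspan[of 0] flat_span_differentiable
    by (auto intro!: continuous_at_imp_continuous_on differentiable_imp_continuous_within)
  \<comment> \<open>Starting the integral at -1 instead of 0 puts the critical point 0 inside the
    range where the fundamental theorem gives a two-sided derivative; further left,
    \<open>G0\<close> is locally 0.\<close>
  define G0 where "G0 = (\<lambda>y. integral {-1..y} b)"
  have G0d: "(G0 has_real_derivative b y) (at y)" for y
  proof (cases "y > -1")
    case True
    have "(G0 has_real_derivative b y) (at y within {-1..y + 1})"
      unfolding G0_def by (rule integral_has_real_derivative[OF bcont]) (use True in auto)
    moreover have "at y within {-1..y + 1} = at y"
      by (rule at_within_interior) (use True in auto)
    ultimately show ?thesis by simp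
  next
    case False
    have "G0 z = 0" if "z < 0" for z
      unfolding G0_def by (rule integral_unique, rule has_integral_is_0) (use that bz in auto)
    have "((\<lambda>x. 0) has_real_derivative 0) (at y)" by simp
    then have "(G0 has_real_derivative 0) (at y)"
      by (rule has_field_derivative_transform_within_open[where S = "{..<0}"])
        (use False \<open>\<And>z. z < 0 \<Longrightarrow> G0 z = 0\<close> in auto)
    then show ?thesis using False bz[of y] by simp
  qed
  have G0z: "G0 y = 0" if "y \<le> 0" for y
    unfolding G0_def by (rule integral_unique, rule has_integral_is_0) (use that bz in auto)
  have mono: "mono G0"
    by (rule monoI) (metis DERIV_nonneg_imp_nondecreasing G0d b0)
  \<comment> \<open>The derivative is positive only strictly between 0 and \<open>e\<close>, so
    strict growth is taken on the inner interval from \<open>e/4\<close> to \<open>e/2\<close> and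
    extended outwards by monotonicity. This makes the normalizing constant \<open>G0 e\<close>
    positive.\<close>
  have "G0 (e/2) > G0 (e/4)"
  proof (rule DERIV_pos_imp_increasing[where f = G0 and a = "e/4" and b = "e/2"])
    fix x assume "e/4 \<le> x" "x \<le> e/2"
    with assms show "\<exists>y. (G0 has_real_derivative y) (at x) \<and> 0 < y"
      using G0d[of x] bpos[of x] by auto
  qed (use assms in auto)
  moreover have "G0 e \<ge> G0 (e/2)" "G0 (e/4) \<ge> G0 0" using mono assms by (auto intro: monoD)
  ultimately have K: "G0 e > 0" using G0z[of 0] by simp
  have G0e: "G0 y = G0 e" if "y \<ge> e" for y
  proof (cases "y = e")
    case False
    show ?thesis
    proof (rule DERIV_isconst_end[where f = G0 and a = e and b = y])
      show "continuous_on {e..y} G0"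
        by (intro continuous_at_imp_continuous_on ballI) (use G0d DERIV_isCont in blast)
      show "(G0 has_real_derivative 0) (at x)" if "e < x" "x < y" for x
        using G0d[of x] bz[of x] that by simp
    qed (use that False in simp)
  qed simp
  show thesis
  \<comment> \<open>The summand with coefficient 0 gives the rescaled bump the shape of
    \<open>flat_span_lincomb\<close>.\<close>
  proof (rule that[of "\<lambda>x. (1 / G0 e) * b x + 0 * b x" "\<lambda>x. G0 x / G0 e"])
    show "flat_span (\<lambda>x. 1 / G0 e * b (x - c) + 0 * b (x - c))" for c
      by (intro flat_span_lincomb bspan)
    show "((\<lambda>x. G0 x / G0 e) has_real_derivative 1 / G0 e * b x + 0 * b x) (at x)" for x
      using K by (auto intro!: derivative_eq_intros G0d)
    show "mono (\<lambda>x. G0 x / G0 e)"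
      using mono K by (auto simp: mono_def divide_right_mono)
    show "0 \<le> 1 / G0 e * b x + 0 * b x" for x
      using b0[of x] K by simp
    show "1 / G0 e * b x + 0 * b x = 0" if "x \<notin> {0..e}" for x
      using bz[of x] that by auto
    show "G0 x / G0 e = 0" if "x \<le> 0" for x
      using G0z[OF that] by simp
    show "G0 x / G0 e = 1" if "e \<le> x" for x
      using G0e[OF that] K by simp
  qed
qed

text \<open>A continuous probability density concentrated on a short interval: integration against
  it is an approximate evaluation at \<open>c\<close>.\<close>

definition unit_bump :: "real \<Rightarrow> real \<Rightarrow> (real \<Rightarrow> real) \<Rightarrow> bool" where
  "unit_bump c e B \<longleftrightarrow> continuous_on UNIV B \<and> (\<forall>x. 0 \<le> B x) \<and>
     (\<forall>x. x \<notin> {c..c + e} \<longrightarrow> B x = 0) \<and> (B has_integral 1) {c..c + e}"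

text \<open>A rising step at \<open>c\<close> minus a rising step at \<open>d\<close> is a smoothed
  indicator whose derivative is a difference of two unit bumps. Testing with it therefore compares
  the values of a function near \<open>c\<close> and near \<open>d\<close>. The room left by
  \<open>a < c\<close> and \<open>d + e < b\<close> keeps the support strictly inside the
  interval.\<close>

lemma step_test_function:
  assumes "a < c" "0 < e" "c + e \<le> d" "d + e < b"
  obtains \<phi> B1 B2 where "test_function a b \<phi>" "\<And>x. 0 \<le> \<phi> x" "\<And>x. \<phi> x \<le> 1"
    "\<And>x. x \<in> {c + e..d} \<Longrightarrow> \<phi> x = 1" "\<And>x. x \<notin> {c<..<d + e} \<Longrightarrow> \<phi> x = 0"
    "\<And>x. deriv \<phi> x = B1 x - B2 x" "unit_bump c e B1" "unit_bump d e B2"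
proof -
  obtain \<beta> G :: "real \<Rightarrow> real" where \<beta>: "\<And>c. flat_span (\<lambda>x. \<beta> (x - c))" "\<And>x. 0 \<le> \<beta> x"
      "\<And>x. x \<notin> {0..e} \<Longrightarrow> \<beta> x = 0"
    and G: "\<And>x. (G has_real_derivative \<beta> x) (at x)"
      "\<And>x. x \<le> 0 \<Longrightarrow> G x = 0" "\<And>x. x \<ge> e \<Longrightarrow> G x = 1" "mono G"
    by (rule bump_exists[OF \<open>0 < e\<close>], rule that)
  have shift: "((\<lambda>x. G (x - z)) has_real_derivative \<beta> (x - z)) (at x)" for x z
    using DERIV_shift[of G "\<beta> (x - z)" x "- z"] G(1)[of "x - z"] by simp
  have ub: "unit_bump z e (\<lambda>x. \<beta> (x - z))" for z
    unfolding unit_bump_def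
  proof (intro conjI allI impI)
    show "continuous_on UNIV (\<lambda>x. \<beta> (x - z))"
      using flat_span_differentiable[OF \<beta>(1)[of z]]
      by (auto intro!: continuous_at_imp_continuous_on differentiable_imp_continuous_within)
    have "((\<lambda>x. \<beta> (x - z)) has_integral (G (z + e - z) - G (z - z))) {z..z + e}"
      by (rule fundamental_theorem_of_calculus)
        (use assms shift in \<open>auto simp: has_real_derivative_iff_has_vector_derivative[symmetric]
          intro: has_field_derivative_at_within\<close>)
    then show "((\<lambda>x. \<beta> (x - z)) has_integral 1) {z..z + e}"
      using G(2)[of 0] G(3)[of e] by simp
  qed (use \<beta> in auto)
  define \<phi> where "\<phi> = (\<lambda>x. G (x - c) - G (x - d))"
  have d\<phi>: "(\<phi> has_real_derivative \<beta> (x - c) - \<beta> (x - d)) (at x)" for x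
    unfolding \<phi>_def by (intro derivative_intros shift)
  then have deriv\<phi>: "deriv \<phi> = (\<lambda>x. 1 * \<beta> (x - c) + (-1) * \<beta> (x - d))"
    by (auto intro!: DERIV_imp_deriv)
  have span: "flat_span (deriv \<phi>)"
    unfolding deriv\<phi> by (intro flat_span_lincomb \<beta>)
  have \<phi>z: "\<phi> x = 0" if "x \<notin> {c<..<d + e}" for x
    using that assms G(2)[of "x - c"] G(2)[of "x - d"] G(3)[of "x - c"] G(3)[of "x - d"]
    unfolding \<phi>_def by auto
  show thesis
  proof
    show "test_function a b \<phi>"
      unfolding test_function_def
    proof (intro conjI allI)
      show "(deriv ^^ m) \<phi> differentiable (at x)" for m x
      proof (cases m)
        case 0
        then show ?thesis using d\<phi> real_differentiable_def by auto
      next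
        \<comment> \<open>Only the derivative of \<open>\<phi>\<close> is known to lie in the span,
          so one derivative is split off before the closure of the span is used.\<close>
        case (Suc n)
        then show ?thesis
          using flat_span_differentiable[OF flat_span_funpow_deriv[OF span, of n]]
          by (simp add: funpow_Suc_right del: funpow.simps)
      qed
      show "\<exists>a' b'. a < a' \<and> b' < b \<and> (\<forall>x. x \<notin> {a'..b'} \<longrightarrow> \<phi> x = 0)"
        by (intro exI[of _ c] exI[of _ "d + e"]) (use assms \<phi>z in auto)
    qed
    show "0 \<le> \<phi> x" for x
      unfolding \<phi>_def using monoD[OF G(4), of "x - d" "x - c"] assms by simp
    have "G x \<in> {0..1}" for x
      using monoD[OF G(4), of "min x 0" x] monoD[OF G(4), of x "max x e"]
        G(2)[of "min x 0"] G(3)[of "max x e"] by auto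
    then show "\<phi> x \<le> 1" for x
      unfolding \<phi>_def by (metis atLeastAtMost_iff diff_mono diff_zero)
    show "\<phi> x = 1" if "x \<in> {c + e..d}" for x
      unfolding \<phi>_def using that G by auto
    show "deriv \<phi> x = \<beta> (x - c) - \<beta> (x - d)" for x
      by (simp add: deriv\<phi>)
  qed (use \<phi>z ub in auto)
qed

text \<open>As the density has integral 1, the constant \<open>w\<close> is its own average, and the
  error is a weighted average of \<open>u x - w\<close> with nonnegative weights.\<close>

lemma unit_bump_average:
  fixes u :: "real \<Rightarrow> 'e::euclidean_space"
  assumes B: "unit_bump c e B" and sub: "a \<le> c" "c + e \<le> b" and u: "continuous_on {a..b} u"
    and near: "\<And>x. x \<in> {c..c + e} \<Longrightarrow> norm (u x - w) \<le> \<eta>"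
  shows "norm ((LINT x:{a..b}|lborel. B x *\<^sub>R u x) - w) \<le> \<eta>"
proof -
  have cont: "continuous_on S B" for S
    using B continuous_on_subset unfolding unit_bump_def by blast
  have "(LINT x:{a..b}|lborel. B x *\<^sub>R u x) = (LINT x:{c..c + e}|lborel. B x *\<^sub>R u x)"
    unfolding set_lebesgue_integral_def
    by (rule Bochner_Integration.integral_cong)
      (use B sub in \<open>auto simp: indicator_def unit_bump_def\<close>)
  also have "\<dots> = integral {c..c + e} (\<lambda>x. B x *\<^sub>R u x)"
    by (intro set_borel_integral_eq_integral borel_integrable_atLeastAtMost' continuous_intros
        cont continuous_on_subset[OF u]) (use sub in auto)
  also have "integral {c..c + e} (\<lambda>x. B x *\<^sub>R u x) - w = integral {c..c + e} (\<lambda>x. B x *\<^sub>R (u x - w))"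
  proof -
    have "((\<lambda>x. B x *\<^sub>R u x) has_integral integral {c..c + e} (\<lambda>x. B x *\<^sub>R u x)) {c..c + e}"
      by (intro integrable_integral integrable_continuous_interval continuous_intros
        cont continuous_on_subset[OF u]) (use sub in auto)
    moreover have "((\<lambda>x. B x *\<^sub>R w) has_integral 1 *\<^sub>R w) {c..c + e}"
      by (rule has_integral_scaleR_left) (use B in \<open>auto simp: unit_bump_def\<close>)
    ultimately have "((\<lambda>x. B x *\<^sub>R u x - B x *\<^sub>R w) has_integral
        integral {c..c + e} (\<lambda>x. B x *\<^sub>R u x) - 1 *\<^sub>R w) {c..c + e}"
      by (rule has_integral_diff)
    then show ?thesis by (simp add: integral_unique scaleR_diff_right)
  qed
  also have "norm \<dots> \<le> integral {c..c + e} (\<lambda>x. B x * \<eta>)"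
  proof (rule integral_norm_bound_integral)
    show "(\<lambda>x. B x *\<^sub>R (u x - w)) integrable_on {c..c + e}"
      by (intro integrable_continuous_interval continuous_intros
        cont continuous_on_subset[OF u]) (use sub in auto)
    show "(\<lambda>x. B x * \<eta>) integrable_on {c..c + e}"
      by (intro integrable_continuous_interval continuous_intros cont)
    show "norm (B x *\<^sub>R (u x - w)) \<le> B x * \<eta>" if "x \<in> {c..c + e}" for x
      using B near[OF that] by (auto simp: unit_bump_def intro: mult_left_mono)
  qed
  also have "\<dots> = \<eta>"
    using has_integral_mult_left[of B 1 "{c..c + e}" \<eta>] B by (simp add: unit_bump_def integral_unique)
  finally show ?thesis .
qed

section \<open>Oscillation bounded by the weak derivative\<close>

lemma test_function_continuous:
  assumes "test_function a b \<phi>"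
  shows "continuous_on S ((deriv ^^ m) \<phi>)"
  using assms unfolding test_function_def
  by (auto intro!: continuous_at_imp_continuous_on differentiable_imp_continuous_within)

lemma set_integrable_continuous_scaleR:
  fixes u :: "real \<Rightarrow> 'e::euclidean_space" and \<phi> :: "real \<Rightarrow> real"
  assumes \<phi>: "continuous_on {a..b} \<phi>" and u: "set_integrable lborel {a..b} u"
  shows "set_integrable lborel {a..b} (\<lambda>x. \<phi> x *\<^sub>R u x)"
proof -
  have "bounded (\<phi> ` {a..b})"
    by (intro compact_imp_bounded compact_continuous_image \<phi>) auto
  then obtain K where K: "\<And>x. x \<in> {a..b} \<Longrightarrow> \<bar>\<phi> x\<bar> \<le> K"
    unfolding bounded_iff by (metis imageI real_norm_def)
  have "set_borel_measurable lborel {a..b} \<phi>"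
    using borel_integrable_atLeastAtMost'[OF \<phi>]
    by (simp add: set_integrable_def set_borel_measurable_def)
  then have "(\<lambda>x. (indicat_real {a..b} x *\<^sub>R \<phi> x) *\<^sub>R (indicat_real {a..b} x *\<^sub>R u x))
      \<in> borel_measurable lborel"
    using u unfolding set_borel_measurable_def set_integrable_def
    by (intro borel_measurable_scaleR[where f = "\<lambda>x. indicat_real {a..b} x *\<^sub>R \<phi> x"])
      (auto dest: borel_measurable_integrable)
  also have "(\<lambda>x. (indicat_real {a..b} x *\<^sub>R \<phi> x) *\<^sub>R (indicat_real {a..b} x *\<^sub>R u x))
      = (\<lambda>x. indicat_real {a..b} x *\<^sub>R (\<phi> x *\<^sub>R u x))"
    by (auto simp: indicator_def)
  finally have meas: "(\<lambda>x. indicat_real {a..b} x *\<^sub>R (\<phi> x *\<^sub>R u x)) \<in> borel_measurable lborel" .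
  show ?thesis
    unfolding set_integrable_def
  proof (rule Bochner_Integration.integrable_bound[OF _ meas])
    show "integrable lborel (\<lambda>x. K *\<^sub>R (indicat_real {a..b} x *\<^sub>R u x))"
      using u unfolding set_integrable_def by (rule integrable_scaleR_right)
    show "AE x in lborel. norm (indicat_real {a..b} x *\<^sub>R \<phi> x *\<^sub>R u x)
        \<le> norm (K *\<^sub>R indicat_real {a..b} x *\<^sub>R u x)"
    proof (rule AE_I2)
      fix x
      show "norm (indicat_real {a..b} x *\<^sub>R \<phi> x *\<^sub>R u x) \<le> norm (K *\<^sub>R indicat_real {a..b} x *\<^sub>R u x)"
        using K[of x] by (cases "x \<in> {a..b}") (auto intro!: mult_right_mono)
    qed
  qed
qed

text \<open>Test with the smoothed indicator of \<open>[c, d]\<close>: the side with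
  \<open>u\<close> is close to \<open>u c - u d\<close>, and the side with \<open>v\<close> is at
  most the integral of its norm since the test function stays between 0 and 1.\<close>

lemma weak_derivative_increment_less:
  fixes u v :: "real \<Rightarrow> 'e::euclidean_space"
  assumes u: "continuous_on {a..b} u" and v: "set_integrable lborel {a..b} v"
    and weak: "has_weak_derivative 1 a b u v" and "a < c" "c < d" "d < b"
  shows "norm (u c - u d) \<le> (LINT x:{a..b}|lborel. norm (v x))"
proof (rule field_le_epsilon)
  fix \<epsilon> :: real assume "0 < \<epsilon>"
  define \<eta> where "\<eta> = \<epsilon> / 2"
  have "\<eta> > 0" using \<open>0 < \<epsilon>\<close> by (simp add: \<eta>_def)
  have near: "\<exists>\<delta>>0. \<forall>x\<in>{a..b}. dist x z < \<delta> \<longrightarrow> norm (u x - u z) \<le> \<eta>" if "z \<in> {a..b}" for z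
    using u that \<open>\<eta> > 0\<close> unfolding continuous_on_iff by (fastforce simp: dist_norm)
  from near[of c] near[of d] obtain \<delta>1 \<delta>2 where \<delta>: "\<delta>1 > 0" "\<delta>2 > 0"
    "\<And>x. x \<in> {a..b} \<Longrightarrow> dist x c < \<delta>1 \<Longrightarrow> norm (u x - u c) \<le> \<eta>"
    "\<And>x. x \<in> {a..b} \<Longrightarrow> dist x d < \<delta>2 \<Longrightarrow> norm (u x - u d) \<le> \<eta>"
    using assms by (auto simp del: dist_real_def)
  \<comment> \<open>The first two entries put the bumps within the continuity radii of
    \<open>u\<close> at \<open>c\<close> and \<open>d\<close>; the last two make them fit, with
    \<open>c + e \<le> d\<close> and \<open>d + e < b\<close>.\<close>
  define e where "e = Min {\<delta>1 / 2, \<delta>2 / 2, (d - c) / 2, (b - d) / 2}"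
  have e: "e > 0" "e < \<delta>1" "e < \<delta>2" "c + e \<le> d" "d + e < b"
    using \<delta> assms by (auto simp: e_def min_def field_simps)
  obtain \<phi> B1 B2 where \<phi>: "test_function a b \<phi>" "\<And>x. 0 \<le> \<phi> x" "\<And>x. \<phi> x \<le> 1"
    "\<And>x. deriv \<phi> x = B1 x - B2 x" "unit_bump c e B1" "unit_bump d e B2"
    using step_test_function[OF \<open>a < c\<close> e(1) e(4,5)] by metis
  let ?I = "\<lambda>B. LINT x:{a..b}|lborel. B x *\<^sub>R u x"
  have B: "continuous_on {a..b} B1" "continuous_on {a..b} B2"
    using \<phi>(5,6) continuous_on_subset unfolding unit_bump_def by blast+
  have I1: "norm (?I B1 - u c) \<le> \<eta>"
    by (rule unit_bump_average[OF \<phi>(5) _ _ u]) (use e assms \<delta> in \<open>auto simp: dist_real_def\<close>)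
  have I2: "norm (?I B2 - u d) \<le> \<eta>"
    by (rule unit_bump_average[OF \<phi>(6) _ _ u]) (use e assms \<delta> in \<open>auto simp: dist_real_def\<close>)
  have "?I (deriv \<phi>) = ?I B1 - ?I B2"
    unfolding \<phi>(4) scaleR_diff_left
    by (intro set_integral_diff borel_integrable_atLeastAtMost' continuous_intros B u)
  moreover have "?I (deriv \<phi>) = - (LINT x:{a..b}|lborel. \<phi> x *\<^sub>R v x)"
    using weak \<phi>(1) unfolding has_weak_derivative_def by auto
  moreover have "norm (LINT x:{a..b}|lborel. \<phi> x *\<^sub>R v x) \<le> (LINT x:{a..b}|lborel. norm (v x))"
    unfolding set_lebesgue_integral_def
  proof (rule order_trans[OF integral_norm_bound Bochner_Integration.integral_mono])
    have c\<phi>: "continuous_on {a..b} \<phi>"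
      using test_function_continuous[OF \<phi>(1), of "{a..b}" 0] by simp
    show "integrable lborel (\<lambda>x. norm (indicat_real {a..b} x *\<^sub>R \<phi> x *\<^sub>R v x))"
      using set_integrable_norm[OF set_integrable_continuous_scaleR[OF c\<phi> v]]
      by (simp add: set_integrable_def abs_mult mult.assoc)
    show "integrable lborel (\<lambda>x. indicat_real {a..b} x *\<^sub>R norm (v x))"
      using set_integrable_norm[OF v] by (simp add: set_integrable_def)
    show "norm (indicat_real {a..b} x *\<^sub>R \<phi> x *\<^sub>R v x) \<le> indicat_real {a..b} x *\<^sub>R norm (v x)" for x
      using \<phi>(2,3)[of x] by (auto simp: indicator_def mult_left_le_one_le)
  qed
  ultimately have "norm (?I B1 - ?I B2) \<le> (LINT x:{a..b}|lborel. norm (v x))"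
    by (metis norm_minus_cancel)
  moreover have "norm (u c - u d) \<le> norm (?I B1 - u c) + norm (?I B2 - u d) + norm (?I B1 - ?I B2)"
  proof -
    have "u c - u d = (?I B2 - u d) - (?I B1 - u c) + (?I B1 - ?I B2)" by simp
    then show ?thesis
      using norm_triangle_ineq[of "(?I B2 - u d) - (?I B1 - u c)" "?I B1 - ?I B2"]
        norm_triangle_ineq4[of "?I B2 - u d" "?I B1 - u c"] by simp
  qed
  ultimately have "norm (u c - u d) \<le> \<eta> + \<eta> + (LINT x:{a..b}|lborel. norm (v x))"
    using I1 I2 by linarith
  then show "norm (u c - u d) \<le> (LINT x:{a..b}|lborel. norm (v x)) + \<epsilon>"
    by (simp add: \<eta>_def)
qed


text \<open>Test functions see only the open interval; continuity of \<open>u\<close> extends the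
  bound to the endpoints, one variable at a time.\<close>

lemma weak_derivative_increment:
  fixes u v :: "real \<Rightarrow> 'e::euclidean_space"
  assumes "a < b" and u: "continuous_on {a..b} u" and v: "set_integrable lborel {a..b} v"
    and weak: "has_weak_derivative 1 a b u v" and "c \<in> {a..b}" "d \<in> {a..b}"
  shows "norm (u c - u d) \<le> (LINT x:{a..b}|lborel. norm (v x))"
proof -
  let ?M = "LINT x:{a..b}|lborel. norm (v x)"
  have M: "?M \<ge> 0"
    by (auto simp: set_lebesgue_integral_def intro!: Bochner_Integration.integral_nonneg)
  have cl: "closure {a<..<b} = {a..b}" using \<open>a < b\<close> by simp
  have 1: "norm (u c - u d) \<le> ?M" if "c \<in> {a<..<b}" "d \<in> {a<..<b}" for c d
  proof (cases c d rule: linorder_cases)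
    case less
    then show ?thesis using weak_derivative_increment_less[OF u v weak] that by auto
  next
    case greater
    then show ?thesis
      using weak_derivative_increment_less[OF u v weak, of d c] that by (auto simp: norm_minus_commute)
  qed (use M in auto)
  have 2: "norm (u c - u d) \<le> ?M" if "c \<in> {a..b}" "d \<in> {a<..<b}" for c d
    by (rule continuous_le_on_closure[of "{a<..<b}" "\<lambda>c. norm (u c - u d)"])
      (use that cl 1 in \<open>auto intro!: continuous_intros u\<close>)
  show ?thesis
    by (rule continuous_le_on_closure[of "{a<..<b}" "\<lambda>d. norm (u c - u d)"])
      (use assms(5,6) cl 2 in \<open>auto intro!: continuous_intros u\<close>)
qed

lemma square_integrable_on_imp_set_integrable:
  assumes "square_integrable_on v a b"
  shows "set_integrable lborel {a..b} v"
proof -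
  have "set_integrable lborel {a..b} (\<lambda>x. 1 + (norm (v x))\<^sup>2)"
    using assms by (intro set_integral_add(1)[OF borel_integrable_atLeastAtMost'[OF continuous_on_const]])
      (auto simp: square_integrable_on_def)
  \<comment> \<open>This is the nonnegativity of the square of \<open>norm y - 1/2\<close>.\<close>
  moreover have "norm y \<le> 1 + (norm y)\<^sup>2" for y :: 'a
    using sum_power2_ge_zero[of "norm y - 1/2" 0] by (simp add: power2_eq_square algebra_simps)
  ultimately show ?thesis
    using assms unfolding square_integrable_on_def
    by (intro set_integrable_bound[where f = "\<lambda>x. 1 + (norm (v x))\<^sup>2" and g = v])
      (auto intro!: AE_I2 simp: abs_of_nonneg)
qed

lemma lborel_set_integral_const:
  fixes c :: real
  assumes "a \<le> b"
  shows "(LINT x:{a..b}|lborel. c) = (b - a) * c"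
  using assms by (simp add: set_lebesgue_integral_def)

lemma lborel_set_integral_const_integrable: "set_integrable lborel {a..b::real} (\<lambda>x. c::real)"
  by (intro borel_integrable_atLeastAtMost' continuous_intros)

text \<open>Integrate Young's inequality \<open>y \<le> \<tau> / 2 + y^2 / (2 * \<tau>)\<close>.
  Compared with the Cauchy-Schwarz inequality the factor \<open>sqrt (b - a)\<close> is replaced by
  the larger \<open>(b - a + 1) / 2\<close>, which is harmless since only some constant is
  wanted.\<close>

lemma L1_bound_of_L2_bound:
  fixes v :: "real \<Rightarrow> 'e::euclidean_space"
  assumes v: "square_integrable_on v a b" and "a \<le> b" and "\<tau> > 0"
    and "(LINT x:{a..b}|lborel. (norm (v x))\<^sup>2) \<le> \<tau>\<^sup>2"
  shows "(LINT x:{a..b}|lborel. norm (v x)) \<le> (b - a + 1) / 2 * \<tau>"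
proof -
  have i1: "set_integrable lborel {a..b} (\<lambda>x. norm (v x))"
    using set_integrable_norm[OF square_integrable_on_imp_set_integrable[OF v]] .
  have i2: "set_integrable lborel {a..b} (\<lambda>x. (norm (v x))\<^sup>2 / (2 * \<tau>))"
    using v by (intro set_integrable_divide) (auto simp: square_integrable_on_def)
  have pw: "norm y \<le> \<tau> / 2 + (norm y)\<^sup>2 / (2 * \<tau>)" for y :: 'e
  proof -
    have "2 * \<tau> * norm y \<le> \<tau>\<^sup>2 + (norm y)\<^sup>2"
      using sum_squares_bound[of \<tau> "norm y"] by simp
    then show ?thesis using \<open>\<tau> > 0\<close> by (simp add: field_simps power2_eq_square)
  qed
  have "(LINT x:{a..b}|lborel. norm (v x)) \<le> (LINT x:{a..b}|lborel. \<tau> / 2 + (norm (v x))\<^sup>2 / (2 * \<tau>))"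
    by (rule set_integral_mono[OF i1 set_integral_add(1)[OF lborel_set_integral_const_integrable i2] pw])
  also have "\<dots> = (b - a) * (\<tau> / 2) + (LINT x:{a..b}|lborel. (norm (v x))\<^sup>2) / (2 * \<tau>)"
    using \<open>a \<le> b\<close>
    by (subst set_integral_add(2)[OF lborel_set_integral_const_integrable i2])
      (simp add: lborel_set_integral_const)
  also have "\<dots> \<le> (b - a) * (\<tau> / 2) + \<tau>\<^sup>2 / (2 * \<tau>)"
    using assms by (intro add_left_mono divide_right_mono) auto
  also have "\<dots> = (b - a + 1) / 2 * \<tau>"
    using \<open>\<tau> > 0\<close> by (simp add: field_simps power2_eq_square)
  finally show ?thesis .
qed

section \<open>The supremum norm is dominated by the Sobolev norm\<close>

lemma weak_derivative_spec:
  assumes "sobolev k a b u" "j \<le> k"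
  shows "square_integrable_on (weak_derivative j a b u) a b"
    "has_weak_derivative j a b u (weak_derivative j a b u)"
  using someI_ex[of "\<lambda>v. square_integrable_on v a b \<and> has_weak_derivative j a b u v"] assms
  unfolding sobolev_def weak_derivative_def by auto

lemma set_integral_power2_norm_nonneg: "0 \<le> (LINT x:{a..b}|lborel. (norm (v x))\<^sup>2)"
  by (auto simp: set_lebesgue_integral_def intro!: Bochner_Integration.integral_nonneg)

lemma sobolev_norm_power2:
  "(sobolev_norm k a b u)\<^sup>2 = (LINT x:{a..b}|lborel. (norm (u x))\<^sup>2) +
     (\<Sum>j=1..k. LINT x:{a..b}|lborel. (norm (weak_derivative j a b u x))\<^sup>2)"
  unfolding sobolev_norm_def
  by (intro real_sqrt_pow2 add_nonneg_nonneg sum_nonneg set_integral_power2_norm_nonneg)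

lemma sobolev_norm_nonneg: "0 \<le> sobolev_norm k a b u"
  unfolding sobolev_norm_def
  by (intro real_sqrt_ge_zero add_nonneg_nonneg sum_nonneg set_integral_power2_norm_nonneg)

lemma L2_le_sobolev_norm: "(LINT x:{a..b}|lborel. (norm (u x))\<^sup>2) \<le> (sobolev_norm k a b u)\<^sup>2"
  unfolding sobolev_norm_power2 by (simp add: sum_nonneg set_integral_power2_norm_nonneg)

lemma weak_derivative_L2_le_sobolev_norm:
  assumes "1 \<le> j" "j \<le> k"
  shows "(LINT x:{a..b}|lborel. (norm (weak_derivative j a b u x))\<^sup>2) \<le> (sobolev_norm k a b u)\<^sup>2"
proof -
  have "(LINT x:{a..b}|lborel. (norm (weak_derivative j a b u x))\<^sup>2) \<le>
    (\<Sum>j=1..k. LINT x:{a..b}|lborel. (norm (weak_derivative j a b u x))\<^sup>2)"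
    using assms by (intro member_le_sum set_integral_power2_norm_nonneg) auto
  then show ?thesis
    unfolding sobolev_norm_power2 using set_integral_power2_norm_nonneg[of a b u] by linarith
qed

lemma continuous_imp_square_integrable_on:
  fixes u :: "real \<Rightarrow> 'e::euclidean_space"
  assumes "continuous_on {a..b} u"
  shows "square_integrable_on u a b"
  unfolding square_integrable_on_def
proof
  show "set_borel_measurable lborel {a..b} u"
    using borel_integrable_atLeastAtMost'[OF assms]
    by (simp add: set_integrable_def set_borel_measurable_def)
  show "set_integrable lborel {a..b} (\<lambda>x. (norm (u x))\<^sup>2)"
    by (intro borel_integrable_atLeastAtMost' continuous_intros assms)
qed

text \<open>The value at \<open>x\<close> exceeds the norm of any other value by at most the
  integral of the norm of the weak derivative; averaging over the other point gives the claim. The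
  first summand of the constant comes from the average of \<open>norm (u y)\<close>, the second from
  the increment.\<close>

lemma sobolev_norm_sup_bound:
  fixes u :: "real \<Rightarrow> 'e::euclidean_space"
  assumes "a < b" "k \<ge> 1" and u: "sobolev k a b u" and x: "x \<in> {a..b}"
  shows "norm (u x) \<le> ((b - a + 1) / 2 / (b - a) + (b - a + 1) / 2) * sobolev_norm k a b u"
proof -
  define K where "K = (b - a + 1) / 2"
  let ?v = "weak_derivative 1 a b u"
  have cont: "continuous_on {a..b} u" using u by (simp add: sobolev_def)
  note v = weak_derivative_spec[OF u \<open>k \<ge> 1\<close>]
  \<comment> \<open>\<open>L1_bound_of_L2_bound\<close> divides by its parameter, so the norm, which
    may be 0, is first replaced by any larger number; \<open>dense_ge\<close> returns to the norm
    itself.\<close>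
  have "norm (u x) \<le> (K / (b - a) + K) * \<tau>" if "\<tau> > sobolev_norm k a b u" for \<tau>
  proof -
    have \<tau>: "\<tau> > 0" "(sobolev_norm k a b u)\<^sup>2 \<le> \<tau>\<^sup>2"
      using that sobolev_norm_nonneg[of k a b u] by (auto intro: power_mono)
    define M where "M = (LINT x:{a..b}|lborel. norm (?v x))"
    have M: "M \<le> K * \<tau>"
      unfolding M_def K_def
      using \<open>a < b\<close> \<tau> weak_derivative_L2_le_sobolev_norm[of 1 k a b u] \<open>k \<ge> 1\<close>
      by (intro L1_bound_of_L2_bound v) auto
    have U: "(LINT x:{a..b}|lborel. norm (u x)) \<le> K * \<tau>"
      unfolding K_def
      using \<open>a < b\<close> \<tau> L2_le_sobolev_norm[of a b u k]
      by (intro L1_bound_of_L2_bound continuous_imp_square_integrable_on cont) auto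
    have pw: "norm (u x) \<le> norm (u y) + M" if "y \<in> {a..b}" for y
    proof -
      have "norm (u x - u y) \<le> M"
        unfolding M_def
        by (rule weak_derivative_increment[OF \<open>a < b\<close> cont _ v(2) x that])
          (rule square_integrable_on_imp_set_integrable[OF v(1)])
      then show ?thesis using norm_triangle_ineq2[of "u x" "u y"] by linarith
    qed
    have i: "set_integrable lborel {a..b} (\<lambda>x. norm (u x))"
      by (intro borel_integrable_atLeastAtMost' continuous_intros cont)
    have "(b - a) * norm (u x) = (LINT y:{a..b}|lborel. norm (u x))"
      using \<open>a < b\<close> by (simp add: lborel_set_integral_const)
    also have "\<dots> \<le> (LINT y:{a..b}|lborel. norm (u y) + M)"
      by (rule set_integral_mono[OF lborel_set_integral_const_integrable
        set_integral_add(1)[OF i lborel_set_integral_const_integrable] pw])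
    also have "\<dots> = (LINT y:{a..b}|lborel. norm (u y)) + (b - a) * M"
      using \<open>a < b\<close>
      by (subst set_integral_add(2)[OF i lborel_set_integral_const_integrable])
        (simp add: lborel_set_integral_const)
    also have "\<dots> \<le> K * \<tau> + (b - a) * (K * \<tau>)"
      using U M \<open>a < b\<close> by (intro add_mono mult_left_mono) auto
    finally show ?thesis
      using \<open>a < b\<close> by (simp add: field_simps)
  qed
  then have "norm (u x) / (K / (b - a) + K) \<le> \<tau>" if "\<tau> > sobolev_norm k a b u" for \<tau>
    using that \<open>a < b\<close> by (simp add: K_def divide_le_eq mult.commute add_pos_pos)
  then have "norm (u x) / (K / (b - a) + K) \<le> sobolev_norm k a b u"
    by (rule dense_ge)
  then show ?thesis
    using \<open>a < b\<close> by (simp add: K_def divide_le_eq mult.commute add_pos_pos)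
qed

section \<open>Uniqueness of weak derivatives\<close>

text \<open>The fundamental lemma of the calculus of variations. Smoothed indicators converge
  boundedly to indicators of half-open intervals, these intervals generate the Borel sets, and an
  integrable function whose integral over every Borel set vanishes is 0 almost everywhere.\<close>

lemma test_function_integral_zero_imp_AE_zero:
  fixes w :: "real \<Rightarrow> 'e::euclidean_space"
  assumes w: "set_integrable lborel {a..b} w"
    and zero: "\<And>\<phi>. test_function a b \<phi> \<Longrightarrow> (LINT x:{a..b}|lborel. \<phi> x *\<^sub>R w x) = 0"
  shows "AE x in lborel. x \<in> {a..b} \<longrightarrow> w x = 0"
proof -
  \<comment> \<open>Cutting off outside the open interval gives a function integrable on the line,
    so that intervals reaching beyond \<open>a\<close> or \<open>b\<close> can be treated as
    well.\<close>
  define W where "W = (\<lambda>x. indicat_real {a<..<b} x *\<^sub>R w x)"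
  have "set_integrable lborel {a<..<b} w"
    by (rule set_integrable_subset[OF w]) auto
  then have W: "integrable lborel W"
    by (simp add: W_def set_integrable_def)
  have half: "(LINT x:{c<..d}|lborel. w x) = 0" if cd: "a < c" "c < d" "d < b" for c d
  proof -
    \<comment> \<open>Flank widths tending to 0 while the plateau stays admissible; half of
      \<open>b - d\<close> secures the strict inequality \<open>d + e n < b\<close>.\<close>
    define e where "e = (\<lambda>n::nat. min (d - c) ((b - d) / 2) / of_nat (Suc n))"
    have e: "0 < e n" "c + e n \<le> d" "d + e n < b" for n
    proof -
      let ?m = "min (d - c) ((b - d) / 2)"
      have m: "0 < ?m" "?m \<le> d - c" "?m < b - d"
        using cd by (auto simp: min_def field_simps)
      have "e n \<le> ?m / 1"
        unfolding e_def using m(1) by (intro divide_left_mono) auto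
      then have "e n \<le> ?m" by (simp only: div_by_1)
      with m have "e n \<le> d - c" "e n < b - d" by (auto simp only: order_trans order_le_less_trans)
      moreover have "0 < e n"
        unfolding e_def using m(1) by (intro divide_pos_pos) auto
      ultimately show "0 < e n" "c + e n \<le> d" "d + e n < b"
        by linarith+
    qed
    have e_lim: "e \<longlonglongrightarrow> 0"
      unfolding e_def by (rule LIMSEQ_Suc[OF lim_const_over_n])
    have "\<exists>\<phi>. test_function a b \<phi> \<and> (\<forall>x. 0 \<le> \<phi> x \<and> \<phi> x \<le> 1) \<and>
        (\<forall>x\<in>{c + e n..d}. \<phi> x = 1) \<and> (\<forall>x. x \<notin> {c<..<d + e n} \<longrightarrow> \<phi> x = 0)" for n
      by (rule step_test_function[OF cd(1) e(1)[of n] e(2)[of n] e(3)[of n]]) blast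
    then obtain \<phi> where \<phi>: "\<And>n. test_function a b (\<phi> n)" "\<And>n x. 0 \<le> \<phi> n x" "\<And>n x. \<phi> n x \<le> 1"
        "\<And>n x. x \<in> {c + e n..d} \<Longrightarrow> \<phi> n x = 1" "\<And>n x. x \<notin> {c<..<d + e n} \<Longrightarrow> \<phi> n x = 0"
      by metis
    \<comment> \<open>The limit contains \<open>d\<close> but not \<open>c\<close>: each test
      function is 1 up to and including \<open>d\<close> and still 0 at \<open>c\<close>. This is
      why half-open intervals appear.\<close>
    have \<phi>_lim: "(\<lambda>n. \<phi> n x) \<longlonglongrightarrow> indicat_real {c<..d} x" for x
    proof (rule tendsto_eventually)
      consider "x \<le> c" | "c < x" "x \<le> d" | "d < x" by linarith
      then show "\<forall>\<^sub>F n in sequentially. \<phi> n x = indicat_real {c<..d} x"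
      proof cases
        case 2
        then have "\<forall>\<^sub>F n in sequentially. e n < x - c"
          using order_tendstoD(2)[OF e_lim, of "x - c"] by simp
        then show ?thesis
          by eventually_elim (use 2 \<phi>(4) in auto)
      next
        case 3
        then have "\<forall>\<^sub>F n in sequentially. e n < x - d"
          using order_tendstoD(2)[OF e_lim, of "x - d"] by simp
        then show ?thesis
          by eventually_elim (use 3 \<phi>(5) in auto)
      qed (use \<phi>(5) in auto)
    qed
    have "(\<lambda>n. LINT x|lborel. indicat_real {a..b} x *\<^sub>R (\<phi> n x *\<^sub>R w x)) \<longlonglongrightarrow>
        (LINT x|lborel. indicat_real {c<..d} x *\<^sub>R w x)"
    proof (rule integral_dominated_convergence)
      show "integrable lborel (\<lambda>x. norm (indicat_real {a..b} x *\<^sub>R w x))"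
        using w by (intro integrable_norm) (simp add: set_integrable_def)
      show "(\<lambda>x. indicat_real {c<..d} x *\<^sub>R w x) \<in> borel_measurable lborel"
      proof -
        have "set_integrable lborel {c<..d} w"
          by (rule set_integrable_subset[OF w]) (use cd in auto)
        then show ?thesis
          unfolding set_integrable_def by (rule borel_measurable_integrable)
      qed
      show "(\<lambda>x. indicat_real {a..b} x *\<^sub>R (\<phi> n x *\<^sub>R w x)) \<in> borel_measurable lborel" for n
        using set_integrable_continuous_scaleR[OF test_function_continuous[OF \<phi>(1)[of n], of "{a..b}" 0] w]
        unfolding set_integrable_def funpow_0 by (rule borel_measurable_integrable)
      show "AE x in lborel. (\<lambda>n. indicat_real {a..b} x *\<^sub>R (\<phi> n x *\<^sub>R w x)) \<longlonglongrightarrow>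
          indicat_real {c<..d} x *\<^sub>R w x"
      proof (rule AE_I2)
        fix x
        have "(\<lambda>n. indicat_real {a..b} x *\<^sub>R (\<phi> n x *\<^sub>R w x)) \<longlonglongrightarrow>
            indicat_real {a..b} x *\<^sub>R (indicat_real {c<..d} x *\<^sub>R w x)"
          by (intro tendsto_intros \<phi>_lim)
        also have "indicat_real {a..b} x *\<^sub>R (indicat_real {c<..d} x *\<^sub>R w x) = indicat_real {c<..d} x *\<^sub>R w x"
          using cd by (auto simp: indicator_def)
        finally show "(\<lambda>n. indicat_real {a..b} x *\<^sub>R (\<phi> n x *\<^sub>R w x)) \<longlonglongrightarrow>
          indicat_real {c<..d} x *\<^sub>R w x" .
      qed
      show "AE x in lborel. norm (indicat_real {a..b} x *\<^sub>R (\<phi> n x *\<^sub>R w x)) \<le>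
          norm (indicat_real {a..b} x *\<^sub>R w x)" for n
        using \<phi>(2,3) by (intro AE_I2) (auto simp: indicator_def mult_left_le_one_le)
    qed
    moreover have "(LINT x|lborel. indicat_real {a..b} x *\<^sub>R (\<phi> n x *\<^sub>R w x)) = 0" for n
      using zero[OF \<phi>(1)[of n]] by (simp add: set_lebesgue_integral_def)
    ultimately show ?thesis
      by (simp add: set_lebesgue_integral_def LIMSEQ_const_iff)
  qed
  have half': "(LINT x:{c<..d}|lborel. W x) = 0" for c d
  proof -
    \<comment> \<open>Endpoints pushed strictly inside the interval, where \<open>half\<close>
      applies; since \<open>W\<close> vanishes outside, the intervals exhaust the relevant part of
      \<open>{c<..d}\<close>.\<close>
    define c' d' where "c' = (\<lambda>n::nat. max c (a + 1 / of_nat (Suc n)))"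
      and "d' = (\<lambda>n::nat. min d (b - 1 / of_nat (Suc n)))"
    have inv: "(\<lambda>n::nat. 1 / real (Suc n)) \<longlonglongrightarrow> 0"
      by (rule LIMSEQ_Suc[OF lim_const_over_n])
    have "(\<lambda>n. LINT x|lborel. indicat_real {c' n<..d' n} x *\<^sub>R W x) \<longlonglongrightarrow>
        (LINT x|lborel. indicat_real {c<..d} x *\<^sub>R W x)"
    proof (rule integral_dominated_convergence)
      show "integrable lborel (\<lambda>x. norm (W x))" using W by simp
      show "(\<lambda>x. indicat_real {c<..d} x *\<^sub>R W x) \<in> borel_measurable lborel"
        "(\<lambda>x. indicat_real {c' n<..d' n} x *\<^sub>R W x) \<in> borel_measurable lborel" for n
        using borel_measurable_integrable[OF W] by measurable
      show "AE x in lborel. (\<lambda>n. indicat_real {c' n<..d' n} x *\<^sub>R W x) \<longlonglongrightarrow> indicat_real {c<..d} x *\<^sub>R W x"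
      proof (intro AE_I2 tendsto_eventually)
        fix x
        show "\<forall>\<^sub>F n in sequentially. indicat_real {c' n<..d' n} x *\<^sub>R W x = indicat_real {c<..d} x *\<^sub>R W x"
        proof (cases "x \<in> {a<..<b}")
          case True
          then have "\<forall>\<^sub>F n in sequentially. 1 / real (Suc n) < x - a"
            "\<forall>\<^sub>F n in sequentially. 1 / real (Suc n) < b - x"
            using order_tendstoD(2)[OF inv] by auto
          then show ?thesis
            by eventually_elim (auto simp: c'_def d'_def indicator_def)
        qed (simp add: W_def)
      qed
      show "AE x in lborel. norm (indicat_real {c' n<..d' n} x *\<^sub>R W x) \<le> norm (W x)" for n
        by (intro AE_I2) (auto simp: indicator_def)
    qed
    moreover have "(LINT x|lborel. indicat_real {c' n<..d' n} x *\<^sub>R W x) = 0" for n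
    proof (cases "c' n < d' n")
      case True
      have "0 < 1 / real (Suc n)" by simp
      then have "a < c' n" "d' n < b"
        unfolding c'_def d'_def less_max_iff_disj min_less_iff_disj by linarith+
      then have "(\<lambda>x. indicat_real {c' n<..d' n} x *\<^sub>R W x) = (\<lambda>x. indicat_real {c' n<..d' n} x *\<^sub>R w x)"
        by (auto simp: W_def indicator_def)
      then show ?thesis
        using half[OF \<open>a < c' n\<close> True \<open>d' n < b\<close>] by (simp add: set_lebesgue_integral_def)
    qed simp
    ultimately show ?thesis
      by (simp add: set_lebesgue_integral_def LIMSEQ_const_iff)
  qed
  \<comment> \<open>Dynkin's argument on the intersection-stable family of half-open intervals. The
    complement step needs the total integral to vanish, and \<open>{a - 1<..b}\<close> already
    contains every point where \<open>W\<close> is nonzero.\<close>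
  have all: "(LINT x:E|lborel. W x) = 0" if "E \<in> sets lborel" for E
  proof -
    let ?G = "range (\<lambda>(c, d). {c<..d::real})"
    have G: "sigma_sets UNIV ?G = sets lborel"
      by (subst sets_lborel, subst borel_sigma_sets_Ioc) simp
    have tot: "(LINT x|lborel. W x) = 0"
    proof -
      have "(LINT x:{a - 1<..b}|lborel. W x) = (LINT x|lborel. W x)"
        unfolding set_lebesgue_integral_def
        by (rule Bochner_Integration.integral_cong) (auto simp: W_def indicator_def)
      then show ?thesis using half' by simp
    qed
    have si: "set_integrable lborel E W" if "E \<in> sets lborel" for E
      using W that by (simp add: set_integrable_def integrable_mult_indicator)
    show ?thesis
    proof (rule sigma_sets_induct_disjoint[of ?G UNIV E "\<lambda>E. (LINT x:E|lborel. W x) = 0"])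
      show "Int_stable ?G"
        unfolding Int_stable_def by (auto simp: Int_greaterThanAtMost)
      show "E \<in> sigma_sets UNIV ?G" using that G by simp
      show "(LINT x:UNIV - F|lborel. W x) = 0"
        if F: "F \<in> sigma_sets UNIV ?G" "(LINT x:F|lborel. W x) = 0" for F
      proof -
        have "F \<in> sets lborel" using F G by simp
        then have "(LINT x:(UNIV - F) \<union> F|lborel. W x) = (LINT x:UNIV - F|lborel. W x) + (LINT x:F|lborel. W x)"
          by (intro set_integral_Un si) auto
        then show ?thesis using F tot by (simp add: set_lebesgue_integral_def)
      qed
      show "(LINT x:(\<Union>i. F i)|lborel. W x) = 0"
        if F: "disjoint_family F" "range F \<subseteq> sigma_sets UNIV ?G"
          "\<And>i. (LINT x:F i|lborel. W x) = 0" for F :: "nat \<Rightarrow> real set"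
      proof -
        have Fs: "F i \<in> sets lborel" for i using F(2) G by auto
        then have "(LINT x:(\<Union>i. F i)|lborel. W x) = (\<Sum>i. LINT x:F i|lborel. W x)"
          using F(1) by (intro lebesgue_integral_countable_add si sets.countable_UN)
            (auto simp: disjoint_family_on_def)
        then show ?thesis using F(3) by simp
      qed
      show "(LINT x:{}|lborel. W x) = 0"
        by (simp add: set_lebesgue_integral_def)
    qed (use half' in auto)
  qed
  have "AE x in lborel. W x = 0"
    by (rule sigma_finite_measure.density_zero[OF sigma_finite_lborel W all])
  \<comment> \<open>\<open>W\<close> carries no information at the two endpoints, which are null
    sets.\<close>
  moreover have "AE x in lborel. x \<noteq> a" "AE x in lborel. x \<noteq> b"
    by (rule AE_lborel_singleton)+
  ultimately show ?thesis
    by eventually_elim (auto simp: W_def indicator_def split: if_splits)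
qed

section \<open>The Sobolev norm and differentiation\<close>

text \<open>The defining identities make the difference of the two candidates orthogonal to every
  test function.\<close>

lemma weak_derivative_unique:
  fixes u v w :: "real \<Rightarrow> 'e::euclidean_space"
  assumes v: "square_integrable_on v a b" "has_weak_derivative j a b u v"
    and w: "square_integrable_on w a b" "has_weak_derivative j a b u w"
  shows "AE x in lborel. x \<in> {a..b} \<longrightarrow> v x = w x"
proof -
  note vi = square_integrable_on_imp_set_integrable[OF v(1)]
  note wi = square_integrable_on_imp_set_integrable[OF w(1)]
  have "AE x in lborel. x \<in> {a..b} \<longrightarrow> v x - w x = 0"
  proof (rule test_function_integral_zero_imp_AE_zero)
    show "set_integrable lborel {a..b} (\<lambda>x. v x - w x)"
      by (intro set_integral_diff vi wi)
    fix \<phi> assume \<phi>: "test_function a b \<phi>"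
    then have c: "continuous_on {a..b} \<phi>"
      using test_function_continuous[of a b \<phi> "{a..b}" 0] by simp
    have "(-1) ^ j *\<^sub>R (LINT x:{a..b}|lborel. \<phi> x *\<^sub>R v x) = (-1) ^ j *\<^sub>R (LINT x:{a..b}|lborel. \<phi> x *\<^sub>R w x)"
      by (rule trans[OF v(2)[unfolded has_weak_derivative_def, rule_format, OF \<phi>, symmetric]
        w(2)[unfolded has_weak_derivative_def, rule_format, OF \<phi>]])
    then have "(LINT x:{a..b}|lborel. \<phi> x *\<^sub>R v x) = (LINT x:{a..b}|lborel. \<phi> x *\<^sub>R w x)"
      by simp
    then show "(LINT x:{a..b}|lborel. \<phi> x *\<^sub>R (v x - w x)) = 0"
      by (simp add: scaleR_diff_right set_integral_diff set_integrable_continuous_scaleR[OF c] vi wi)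
  qed
  then show ?thesis by simp
qed

section \<open>Linear combinations in the Sobolev space\<close>

lemma set_integral_scaleR_lincomb:
  fixes u w :: "real \<Rightarrow> 'e::euclidean_space"
  assumes \<phi>: "continuous_on {a..b} \<phi>"
    and u: "set_integrable lborel {a..b} u" and w: "set_integrable lborel {a..b} w"
  shows "(LINT x:{a..b}|lborel. \<phi> x *\<^sub>R (u x + z *\<^sub>R w x)) =
    (LINT x:{a..b}|lborel. \<phi> x *\<^sub>R u x) + z *\<^sub>R (LINT x:{a..b}|lborel. \<phi> x *\<^sub>R w x)"
proof -
  note iu = set_integrable_continuous_scaleR[OF \<phi> u]
  have iw: "set_integrable lborel {a..b} (\<lambda>x. z *\<^sub>R (\<phi> x *\<^sub>R w x))"
    by (intro set_integrable_scaleR_right set_integrable_continuous_scaleR[OF \<phi> w])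
  have "(LINT x:{a..b}|lborel. \<phi> x *\<^sub>R (u x + z *\<^sub>R w x)) =
      (LINT x:{a..b}|lborel. \<phi> x *\<^sub>R u x + z *\<^sub>R (\<phi> x *\<^sub>R w x))"
    by (simp add: scaleR_add_right mult.commute)
  also have "\<dots> = (LINT x:{a..b}|lborel. \<phi> x *\<^sub>R u x) + z *\<^sub>R (LINT x:{a..b}|lborel. \<phi> x *\<^sub>R w x)"
    by (simp only: set_integral_add(2)[OF iu iw] set_integral_scaleR_right)
  finally show ?thesis .
qed

lemma has_weak_derivative_lincomb:
  fixes u w :: "real \<Rightarrow> 'e::euclidean_space"
  assumes u: "continuous_on {a..b} u" "has_weak_derivative j a b u u'" "square_integrable_on u' a b"
    and w: "continuous_on {a..b} w" "has_weak_derivative j a b w w'" "square_integrable_on w' a b"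
  shows "has_weak_derivative j a b (\<lambda>x. u x + z *\<^sub>R w x) (\<lambda>x. u' x + z *\<^sub>R w' x)"
  unfolding has_weak_derivative_def
proof (intro allI impI)
  fix \<phi> assume \<phi>: "test_function a b \<phi>"
  have c: "continuous_on {a..b} ((deriv ^^ j) \<phi>)" "continuous_on {a..b} \<phi>"
    using test_function_continuous[OF \<phi>, of "{a..b}" j] test_function_continuous[OF \<phi>, of "{a..b}" 0]
    by simp_all
  have "(LINT x:{a..b}|lborel. (deriv ^^ j) \<phi> x *\<^sub>R (u x + z *\<^sub>R w x)) =
      (LINT x:{a..b}|lborel. (deriv ^^ j) \<phi> x *\<^sub>R u x) + z *\<^sub>R (LINT x:{a..b}|lborel. (deriv ^^ j) \<phi> x *\<^sub>R w x)"
    by (intro set_integral_scaleR_lincomb c borel_integrable_atLeastAtMost' u w)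
  also have "\<dots> = (-1) ^ j *\<^sub>R ((LINT x:{a..b}|lborel. \<phi> x *\<^sub>R u' x) + z *\<^sub>R (LINT x:{a..b}|lborel. \<phi> x *\<^sub>R w' x))"
    using u(2) w(2) \<phi> unfolding has_weak_derivative_def
    by (simp add: scaleR_add_right scaleR_left_commute)
  also have "\<dots> = (-1) ^ j *\<^sub>R (LINT x:{a..b}|lborel. \<phi> x *\<^sub>R (u' x + z *\<^sub>R w' x))"
    by (subst set_integral_scaleR_lincomb)
      (auto intro!: c square_integrable_on_imp_set_integrable u w)
  finally show "(LINT x:{a..b}|lborel. (deriv ^^ j) \<phi> x *\<^sub>R (u x + z *\<^sub>R w x)) =
      (-1) ^ j *\<^sub>R (LINT x:{a..b}|lborel. \<phi> x *\<^sub>R (u' x + z *\<^sub>R w' x))" .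
qed

text \<open>The factor 2 comes from \<open>2 * p * q \<le> p^2 + q^2\<close>. This quadratic bound
  replaces the triangle inequality for the Sobolev norm; for limits equal to 0 the constant is
  irrelevant.\<close>

lemma norm_lincomb_power2_le:
  fixes x y :: "'e::real_inner"
  shows "(norm (x + z *\<^sub>R y))\<^sup>2 \<le> 2 * (norm x)\<^sup>2 + 2 * z\<^sup>2 * (norm y)\<^sup>2"
proof -
  have "norm (x + z *\<^sub>R y) \<le> norm x + \<bar>z\<bar> * norm y"
    using norm_triangle_ineq[of x "z *\<^sub>R y"] by simp
  then have "(norm (x + z *\<^sub>R y))\<^sup>2 \<le> (norm x + \<bar>z\<bar> * norm y)\<^sup>2"
    by (intro power_mono) auto
  also have "\<dots> \<le> 2 * (norm x)\<^sup>2 + 2 * (\<bar>z\<bar> * norm y)\<^sup>2"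
    using sum_squares_bound[of "norm x" "\<bar>z\<bar> * norm y"] by (simp add: power2_sum)
  finally show ?thesis by (simp add: power_mult_distrib)
qed

lemma square_integrable_on_lincomb:
  fixes v w :: "real \<Rightarrow> 'e::euclidean_space"
  assumes v: "square_integrable_on v a b" and w: "square_integrable_on w a b"
  shows "square_integrable_on (\<lambda>x. v x + z *\<^sub>R w x) a b"
    and "(LINT x:{a..b}|lborel. (norm (v x + z *\<^sub>R w x))\<^sup>2) \<le>
      2 * (LINT x:{a..b}|lborel. (norm (v x))\<^sup>2) + 2 * z\<^sup>2 * (LINT x:{a..b}|lborel. (norm (w x))\<^sup>2)"
proof -
  have i: "set_integrable lborel {a..b} (\<lambda>x. v x + z *\<^sub>R w x)"
    using square_integrable_on_imp_set_integrable[OF v] square_integrable_on_imp_set_integrable[OF w]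
    by (intro set_integral_add(1)) auto
  have i1: "set_integrable lborel {a..b} (\<lambda>x. 2 * (norm (v x))\<^sup>2)"
    and i2: "set_integrable lborel {a..b} (\<lambda>x. 2 * z\<^sup>2 * (norm (w x))\<^sup>2)"
    using v w by (auto simp: square_integrable_on_def)
  have m: "(\<lambda>x. indicat_real {a..b} x *\<^sub>R (v x + z *\<^sub>R w x)) \<in> borel_measurable lborel"
    using i unfolding set_integrable_def by (rule borel_measurable_integrable)
  have "(\<lambda>x. (norm (indicat_real {a..b} x *\<^sub>R (v x + z *\<^sub>R w x)))\<^sup>2) \<in> borel_measurable lborel"
    using m by measurable
  also have "(\<lambda>x. (norm (indicat_real {a..b} x *\<^sub>R (v x + z *\<^sub>R w x)))\<^sup>2) =
      (\<lambda>x. indicat_real {a..b} x *\<^sub>R (norm (v x + z *\<^sub>R w x))\<^sup>2)"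
    by (auto simp: indicator_def)
  finally have m2: "set_borel_measurable lborel {a..b} (\<lambda>x. (norm (v x + z *\<^sub>R w x))\<^sup>2)"
    by (simp add: set_borel_measurable_def)
  have i3: "set_integrable lborel {a..b} (\<lambda>x. (norm (v x + z *\<^sub>R w x))\<^sup>2)"
    by (rule set_integrable_bound[OF set_integral_add(1)[OF i1 i2] m2])
      (use norm_lincomb_power2_le in \<open>auto intro!: AE_I2 order_trans[OF _ abs_ge_self]\<close>)
  show "square_integrable_on (\<lambda>x. v x + z *\<^sub>R w x) a b"
    using m i3 by (simp add: square_integrable_on_def set_borel_measurable_def)
  have "(LINT x:{a..b}|lborel. (norm (v x + z *\<^sub>R w x))\<^sup>2) \<le>
      (LINT x:{a..b}|lborel. 2 * (norm (v x))\<^sup>2 + 2 * z\<^sup>2 * (norm (w x))\<^sup>2)"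
    by (rule set_integral_mono[OF i3 set_integral_add(1)[OF i1 i2]]) (rule norm_lincomb_power2_le)
  also have "\<dots> = 2 * (LINT x:{a..b}|lborel. (norm (v x))\<^sup>2) + 2 * z\<^sup>2 * (LINT x:{a..b}|lborel. (norm (w x))\<^sup>2)"
    by (simp only: set_integral_add(2)[OF i1 i2] set_integral_mult_right)
  finally show "(LINT x:{a..b}|lborel. (norm (v x + z *\<^sub>R w x))\<^sup>2) \<le>
      2 * (LINT x:{a..b}|lborel. (norm (v x))\<^sup>2) + 2 * z\<^sup>2 * (LINT x:{a..b}|lborel. (norm (w x))\<^sup>2)" .
qed

lemma sobolev_lincomb:
  fixes u w :: "real \<Rightarrow> 'e::euclidean_space"
  assumes u: "sobolev k a b u" and w: "sobolev k a b w"
  shows "sobolev k a b (\<lambda>x. u x + z *\<^sub>R w x)"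
  unfolding sobolev_def
proof (intro conjI allI impI)
  show "continuous_on {a..b} (\<lambda>x. u x + z *\<^sub>R w x)"
    using u w by (auto simp: sobolev_def intro!: continuous_intros)
  fix j assume "j \<le> k"
  have c: "continuous_on {a..b} u" "continuous_on {a..b} w" using u w by (auto simp: sobolev_def)
  note U = weak_derivative_spec[OF u \<open>j \<le> k\<close>]
  note W = weak_derivative_spec[OF w \<open>j \<le> k\<close>]
  show "\<exists>v. square_integrable_on v a b \<and> has_weak_derivative j a b (\<lambda>x. u x + z *\<^sub>R w x) v"
    using square_integrable_on_lincomb(1)[OF U(1) W(1), of z]
      has_weak_derivative_lincomb[OF c(1) U(2,1) c(2) W(2,1), of z] by blast
qed

text \<open>The weak derivative chosen for the combination need not be the combination of the chosen
  ones. By uniqueness they agree almost everywhere, which is enough for equality of the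
  integrals.\<close>

lemma sobolev_norm_lincomb:
  fixes u w :: "real \<Rightarrow> 'e::euclidean_space"
  assumes u: "sobolev k a b u" and w: "sobolev k a b w"
  shows "(sobolev_norm k a b (\<lambda>x. u x + z *\<^sub>R w x))\<^sup>2 \<le>
    2 * (sobolev_norm k a b u)\<^sup>2 + 2 * z\<^sup>2 * (sobolev_norm k a b w)\<^sup>2"
proof -
  let ?q = "\<lambda>v. LINT x:{a..b}|lborel. (norm (v x :: 'e))\<^sup>2"
  let ?f = "\<lambda>x. u x + z *\<^sub>R w x"
  have c: "continuous_on {a..b} u" "continuous_on {a..b} w" using u w by (auto simp: sobolev_def)
  have 0: "?q ?f \<le> 2 * ?q u + 2 * z\<^sup>2 * ?q w"
    by (intro square_integrable_on_lincomb continuous_imp_square_integrable_on c)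
  have "?q (weak_derivative j a b ?f) \<le> 2 * ?q (weak_derivative j a b u) + 2 * z\<^sup>2 * ?q (weak_derivative j a b w)"
    if "j \<in> {1..k}" for j
  proof -
    from that have "j \<le> k" by simp
    note U = weak_derivative_spec[OF u \<open>j \<le> k\<close>]
    note W = weak_derivative_spec[OF w \<open>j \<le> k\<close>]
    note F = weak_derivative_spec[OF sobolev_lincomb[OF u w] \<open>j \<le> k\<close>, of z]
    let ?g = "\<lambda>x. weak_derivative j a b u x + z *\<^sub>R weak_derivative j a b w x"
    have G: "square_integrable_on ?g a b"
      by (rule square_integrable_on_lincomb(1)[OF U(1) W(1)])
    have "AE x in lborel. x \<in> {a..b} \<longrightarrow> weak_derivative j a b ?f x = ?g x"
      by (rule weak_derivative_unique[OF F G])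
        (rule has_weak_derivative_lincomb[OF c(1) U(2,1) c(2) W(2,1)])
    then have "?q (weak_derivative j a b ?f) = ?q ?g"
      unfolding set_lebesgue_integral_def
    proof (intro integral_cong_AE)
      have "(\<lambda>x. indicat_real {a..b} x *\<^sub>R (norm (v x))\<^sup>2) \<in> borel_measurable lborel"
        if "square_integrable_on v a b" for v :: "real \<Rightarrow> 'e"
        using that unfolding square_integrable_on_def set_integrable_def
        by (intro borel_measurable_integrable) simp
      from this[OF F(1)] this[OF G]
      show "(\<lambda>x. indicat_real {a..b} x *\<^sub>R (norm (weak_derivative j a b ?f x))\<^sup>2) \<in> borel_measurable lborel"
        "(\<lambda>x. indicat_real {a..b} x *\<^sub>R (norm (?g x))\<^sup>2) \<in> borel_measurable lborel" .
    qed (auto elim!: eventually_mono simp: indicator_def)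
    then show ?thesis
      using square_integrable_on_lincomb(2)[OF U(1) W(1), of z] by simp
  qed
  then have "(\<Sum>j=1..k. ?q (weak_derivative j a b ?f)) \<le>
      (\<Sum>j=1..k. 2 * ?q (weak_derivative j a b u) + 2 * z\<^sup>2 * ?q (weak_derivative j a b w))"
    by (rule sum_mono)
  then show ?thesis
    using 0 unfolding sobolev_norm_power2 by (simp add: sum.distrib sum_distrib_left algebra_simps)
qed

text \<open>The conclusion equates predicates of the derivative, so the choice operator in
  \<open>weak_derivative\<close> selects the same function on both sides. That gives the congruence
  for the norm.\<close>

lemma has_weak_derivative_cong:
  assumes "\<And>x. x \<in> {a..b} \<Longrightarrow> u x = w x"
  shows "has_weak_derivative j a b u = has_weak_derivative j a b w"
proof -
  have "(LINT x:{a..b}|lborel. \<phi> x *\<^sub>R u x) = (LINT x:{a..b}|lborel. \<phi> x *\<^sub>R w x)" for \<phi>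
    by (rule set_lebesgue_integral_cong) (simp_all add: assms)
  then show ?thesis unfolding has_weak_derivative_def fun_eq_iff by simp
qed

lemma sobolev_cong:
  assumes "\<And>x. x \<in> {a..b} \<Longrightarrow> u x = w x"
  shows "sobolev k a b u = sobolev k a b w"
proof -
  have "has_weak_derivative j a b u = has_weak_derivative j a b w" for j
    by (rule has_weak_derivative_cong) (rule assms)
  moreover have "continuous_on {a..b} u \<longleftrightarrow> continuous_on {a..b} w"
    by (rule continuous_on_cong) (auto simp: assms)
  ultimately show ?thesis by (simp add: sobolev_def)
qed

lemma sobolev_norm_cong:
  assumes "\<And>x. x \<in> {a..b} \<Longrightarrow> u x = w x"
  shows "sobolev_norm k a b u = sobolev_norm k a b w"
proof -
  have "(LINT x:{a..b}|lborel. (norm (u x))\<^sup>2) = (LINT x:{a..b}|lborel. (norm (w x))\<^sup>2)"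
    by (rule set_lebesgue_integral_cong) (simp_all add: assms)
  moreover have "has_weak_derivative j a b u = has_weak_derivative j a b w" for j
    by (rule has_weak_derivative_cong) (rule assms)
  ultimately show ?thesis
    by (simp add: sobolev_norm_def weak_derivative_def)
qed

lemma sobolev_has_derivative_cong:
  assumes "p \<in> S" and u: "\<And>q x. q \<in> S \<Longrightarrow> x \<in> {a..b} \<Longrightarrow> u q x = w q x"
    and L: "\<And>v x. x \<in> {a..b} \<Longrightarrow> L v x = M v x"
  shows "sobolev_has_derivative k a b u L p S \<longleftrightarrow> sobolev_has_derivative k a b w M p S"
proof -
  have 1: "(\<forall>v. sobolev k a b (L v)) \<longleftrightarrow> (\<forall>v. sobolev k a b (M v))"
    using sobolev_cong[of a b "L _" "M _" k] L by blast
  have 2: "(\<forall>v w z. \<forall>x\<in>{a..b}. L (v + z *\<^sub>R w) x = L v x + z *\<^sub>R L w x) \<longleftrightarrow>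
      (\<forall>v w z. \<forall>x\<in>{a..b}. M (v + z *\<^sub>R w) x = M v x + z *\<^sub>R M w x)"
    using L by simp
  have "sobolev_norm k a b (\<lambda>x. u q x - u p x - L (q - p) x) =
      sobolev_norm k a b (\<lambda>x. w q x - w p x - M (q - p) x)" if "q \<in> S" for q
    by (rule sobolev_norm_cong) (use u L \<open>p \<in> S\<close> that in simp)
  then have 3: "((\<lambda>q. sobolev_norm k a b (\<lambda>x. u q x - u p x - L (q - p) x) / norm (q - p)) \<longlongrightarrow> 0) (at p within S) \<longleftrightarrow>
      ((\<lambda>q. sobolev_norm k a b (\<lambda>x. w q x - w p x - M (q - p) x) / norm (q - p)) \<longlongrightarrow> 0) (at p within S)"
    by (intro tendsto_cong) (auto simp: eventually_at_filter)
  show ?thesis unfolding sobolev_has_derivative_def 1 2 3 ..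
qed

text \<open>No induction is called for: in the successor case the same derivative \<open>u'\<close>
  serves both maps, and the condition on \<open>u'\<close> does not mention them.\<close>

lemma sobolev_Ck_cong:
  assumes "\<And>q x. q \<in> S \<Longrightarrow> x \<in> {a..b} \<Longrightarrow> u q x = w q x"
  shows "sobolev_Ck m k a b u S \<longleftrightarrow> sobolev_Ck m k a b w S"
proof (cases m)
  case 0
  have 1: "sobolev k a b (u p) \<longleftrightarrow> sobolev k a b (w p)" if "p \<in> S" for p
    using assms that by (intro sobolev_cong) auto
  have "((\<lambda>q. sobolev_norm k a b (\<lambda>x. u q x - u p x)) \<longlongrightarrow> 0) (at p within S) \<longleftrightarrow>
     ((\<lambda>q. sobolev_norm k a b (\<lambda>x. w q x - w p x)) \<longlongrightarrow> 0) (at p within S)" if "p \<in> S" for p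
  proof -
    have "sobolev_norm k a b (\<lambda>x. u q x - u p x) = sobolev_norm k a b (\<lambda>x. w q x - w p x)" if "q \<in> S" for q
      by (rule sobolev_norm_cong) (use assms \<open>p \<in> S\<close> that in simp)
    then show ?thesis by (intro tendsto_cong) (auto simp: eventually_at_filter)
  qed
  with 0 1 show ?thesis by simp
next
  case (Suc n)
  have 1: "sobolev k a b (u p) \<longleftrightarrow> sobolev k a b (w p)" if "p \<in> S" for p
    using assms that by (intro sobolev_cong) auto
  have 2: "sobolev_has_derivative k a b u L p S \<longleftrightarrow> sobolev_has_derivative k a b w L p S" if "p \<in> S" for p L
    using assms that by (intro sobolev_has_derivative_cong) auto
  show ?thesis using 1 2 Suc by simp
qed

section \<open>From derivatives in norm to pointwise derivatives\<close>

lemma sobolev_has_derivative_scaleR: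
  assumes "sobolev_has_derivative k a b u L (t::real) S" "x \<in> {a..b}"
  shows "L z x = z *\<^sub>R L 1 x"
proof -
  have lin: "L (v + z *\<^sub>R w) x = L v x + z *\<^sub>R L w x" for v w z
    using assms unfolding sobolev_has_derivative_def by blast
  have "L 0 x = 0" using lin[of 0 1 0] by simp
  then show ?thesis using lin[of 0 z 1] by simp
qed

text \<open>Evaluation at \<open>x\<close> is bounded by the Sobolev norm with a constant
  independent of the time \<open>q\<close>, so the remainder stays of smaller order than
  \<open>q - t\<close> after evaluation.\<close>

lemma sobolev_has_derivative_pointwise:
  fixes u :: "real \<Rightarrow> real \<Rightarrow> 'e::euclidean_space"
  assumes "a < b" "k \<ge> 1" and u: "\<And>q. q \<in> S \<Longrightarrow> sobolev k a b (u q)"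
    and D: "sobolev_has_derivative k a b u L t S" and "t \<in> S" and x: "x \<in> {a..b}"
  shows "((\<lambda>r. u r x) has_vector_derivative L 1 x) (at t within S)"
proof -
  define C where "C = (b - a + 1) / 2 / (b - a) + (b - a + 1) / 2"
  let ?N = "\<lambda>q. sobolev_norm k a b (\<lambda>x. u q x - u t x - L (q - t) x)"
  have L: "sobolev k a b (L v)" for v using D by (auto simp: sobolev_has_derivative_def)
  have bound: "norm (u q x - u t x - (q - t) *\<^sub>R L 1 x) \<le> C * ?N q" if "q \<in> S" for q
  proof -
    have "sobolev k a b (\<lambda>x. (u q x + (-1) *\<^sub>R u t x) + (-1) *\<^sub>R L (q - t) x)"
      by (intro sobolev_lincomb u L that \<open>t \<in> S\<close>)
    then have "sobolev k a b (\<lambda>x. u q x - u t x - L (q - t) x)" by simp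
    from sobolev_norm_sup_bound[OF \<open>a < b\<close> \<open>k \<ge> 1\<close> this x] show ?thesis
      using sobolev_has_derivative_scaleR[OF D x, of "q - t"] by (simp add: C_def)
  qed
  have "((\<lambda>q. ?N q / norm (q - t)) \<longlongrightarrow> 0) (at t within S)"
    using D by (simp add: sobolev_has_derivative_def)
  then have lim: "((\<lambda>q. C * (?N q / norm (q - t))) \<longlongrightarrow> 0) (at t within S)"
    by (rule tendsto_mult_right_zero)
  have "((\<lambda>q. norm (u q x - u t x - (q - t) *\<^sub>R L 1 x) / norm (q - t)) \<longlongrightarrow> 0) (at t within S)"
  proof (rule Lim_null_comparison[OF _ lim])
    show "\<forall>\<^sub>F q in at t within S. norm (norm (u q x - u t x - (q - t) *\<^sub>R L 1 x) / norm (q - t))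
        \<le> C * (?N q / norm (q - t))"
      unfolding eventually_at_filter
    proof (intro always_eventually allI impI)
      fix q assume "q \<noteq> t" "q \<in> S"
      then show "norm (norm (u q x - u t x - (q - t) *\<^sub>R L 1 x) / norm (q - t)) \<le> C * (?N q / norm (q - t))"
        using divide_right_mono[OF bound[OF \<open>q \<in> S\<close>], of "norm (q - t)"] by simp
    qed
  qed
  then show ?thesis
    unfolding has_vector_derivative_def has_derivative_iff_norm
    by (simp add: bounded_linear_scaleR_left)
qed

lemma sobolev_has_derivative_continuous:
  fixes u :: "real \<Rightarrow> real \<Rightarrow> 'e::euclidean_space"
  assumes u: "\<And>q. q \<in> S \<Longrightarrow> sobolev k a b (u q)"
    and D: "sobolev_has_derivative k a b u L t S" and "t \<in> S"
  shows "((\<lambda>q. sobolev_norm k a b (\<lambda>x. u q x - u t x)) \<longlongrightarrow> 0) (at t within S)"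
proof -
  let ?N = "\<lambda>q. sobolev_norm k a b (\<lambda>x. u q x - u t x - L (q - t) x)"
  \<comment> \<open>The increment is the remainder plus \<open>(q - t) *\<^sub>R L 1\<close>. The
    norm of the remainder is written as quotient times \<open>norm (q - t)\<close>, since only the
    quotient is known to converge.\<close>
  let ?E = "\<lambda>q. 2 * (?N q / norm (q - t) * norm (q - t))\<^sup>2 + 2 * (q - t)\<^sup>2 * (sobolev_norm k a b (L 1))\<^sup>2"
  have L: "sobolev k a b (L v)" for v using D by (auto simp: sobolev_has_derivative_def)
  have bound: "(sobolev_norm k a b (\<lambda>x. u q x - u t x))\<^sup>2 \<le> ?E q" if "q \<in> S" "q \<noteq> t" for q
  proof -
    let ?w = "\<lambda>x. u q x - u t x - L (q - t) x"
    have "sobolev k a b (\<lambda>x. (u q x + (-1) *\<^sub>R u t x) + (-1) *\<^sub>R L (q - t) x)"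
      by (intro sobolev_lincomb u L that \<open>t \<in> S\<close>)
    then have w: "sobolev k a b ?w" by simp
    have "sobolev_norm k a b (\<lambda>x. u q x - u t x) = sobolev_norm k a b (\<lambda>x. ?w x + (q - t) *\<^sub>R L 1 x)"
      using sobolev_has_derivative_scaleR[OF D, of _ "q - t"] by (intro sobolev_norm_cong) simp
    then show ?thesis
      using sobolev_norm_lincomb[OF w L[of 1], of "q - t"] that by simp
  qed
  have lim: "((\<lambda>q. ?N q / norm (q - t)) \<longlongrightarrow> 0) (at t within S)"
    using D by (simp add: sobolev_has_derivative_def)
  have id: "((\<lambda>q. q - t) \<longlongrightarrow> t - t) (at t within S)" by (intro tendsto_intros)
  have "((\<lambda>q. sqrt (?E q)) \<longlongrightarrow> sqrt (2 * (0 * norm (t - t))\<^sup>2 + 2 * (t - t)\<^sup>2 * (sobolev_norm k a b (L 1))\<^sup>2)) (at t within S)"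
    by (intro tendsto_intros lim id)
  then have E: "((\<lambda>q. sqrt (?E q)) \<longlongrightarrow> 0) (at t within S)" by simp
  show ?thesis
  proof (rule Lim_null_comparison[OF _ E])
    show "\<forall>\<^sub>F q in at t within S. norm (sobolev_norm k a b (\<lambda>x. u q x - u t x)) \<le> sqrt (?E q)"
      unfolding eventually_at_filter
      using bound sobolev_norm_nonneg by (intro always_eventually) (auto intro: real_le_rsqrt)
  qed
qed

lemma sobolev_Ck_sobolev: "sobolev_Ck m k a b u S \<Longrightarrow> p \<in> S \<Longrightarrow> sobolev k a b (u p)"
  by (cases m) auto

lemma sobolev_Ck_Suc_imp:
  fixes u :: "real \<Rightarrow> real \<Rightarrow> 'e::euclidean_space"
  shows "sobolev_Ck (Suc m) k a b u S \<Longrightarrow> sobolev_Ck m k a b u S"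
proof (induction m arbitrary: u)
  case 0
  then show ?case by (auto intro: sobolev_has_derivative_continuous)
next
  case (Suc m)
  then obtain u' where u': "\<forall>p\<in>S. sobolev_has_derivative k a b u (u' p) p S"
    "\<forall>v. sobolev_Ck (Suc m) k a b (\<lambda>p. u' p v) S" and u: "\<forall>p\<in>S. sobolev k a b (u p)"
    unfolding sobolev_Ck.simps(2)[of "Suc m"] by blast
  then have "\<forall>v. sobolev_Ck m k a b (\<lambda>p. u' p v) S" using Suc.IH by blast
  then show ?case using u u' by (auto simp: sobolev_Ck.simps(2))
qed

lemma sobolev_Ck_imp_curve_Ck:
  fixes u :: "real \<Rightarrow> real \<Rightarrow> 'e::euclidean_space"
  assumes "a < b" "k \<ge> 1" "x \<in> {a..b}"
  shows "sobolev_Ck m k a b u S \<Longrightarrow> curve_Ck m (\<lambda>r. u r x) S"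
proof (induction m arbitrary: u)
  case 0
  define C where "C = (b - a + 1) / 2 / (b - a) + (b - a + 1) / 2"
  have "((\<lambda>r. u r x) \<longlongrightarrow> u t x) (at t within S)" if "t \<in> S" for t
  proof -
    have lim: "((\<lambda>q. C * sobolev_norm k a b (\<lambda>x. u q x - u t x)) \<longlongrightarrow> 0) (at t within S)"
      using 0 that by (intro tendsto_mult_right_zero) simp
    have "norm (u q x - u t x) \<le> C * sobolev_norm k a b (\<lambda>x. u q x - u t x)" if "q \<in> S" for q
    proof -
      have "sobolev k a b (\<lambda>x. u q x + (-1) *\<^sub>R u t x)"
        using 0 that \<open>t \<in> S\<close> by (intro sobolev_lincomb) simp_all
      then have "sobolev k a b (\<lambda>x. u q x - u t x)" by simp
      from sobolev_norm_sup_bound[OF assms(1,2) this assms(3)] show ?thesis by (simp add: C_def)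
    qed
    then have "((\<lambda>r. u r x - u t x) \<longlongrightarrow> 0) (at t within S)"
      by (intro Lim_null_comparison[OF _ lim]) (auto simp: eventually_at_filter)
    then show ?thesis by (rule Lim_null[THEN iffD2])
  qed
  then show ?case by (simp add: continuous_on_def)
next
  case (Suc m)
  then obtain u' where u': "\<forall>p\<in>S. sobolev_has_derivative k a b u (u' p) p S"
    "\<forall>v. sobolev_Ck m k a b (\<lambda>p. u' p v) S" and u: "\<forall>p\<in>S. sobolev k a b (u p)"
    unfolding sobolev_Ck.simps(2) by blast
  have "\<forall>t\<in>S. ((\<lambda>r. u r x) has_vector_derivative u' t 1 x) (at t within S)"
    using u' u by (auto intro: sobolev_has_derivative_pointwise[OF assms(1,2) _ _ _ assms(3)])
  moreover have "curve_Ck m (\<lambda>r. u' r 1 x) S" using Suc.IH u'(2) by blast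
  ultimately show ?case by auto
qed

section \<open>Holomorphic transition maps and velocities of curves\<close>

lemma norm_vector_smult: "norm (c *s x) = cmod c * norm (x :: complex ^ 'n::finite)"
  by (simp add: norm_vec_def L2_set_def norm_mult power_mult_distrib sum_distrib_left[symmetric]
    real_sqrt_mult)

lemma holomorphic_map_on_frechet:
  assumes "holomorphic_map_on F S" "z \<in> S"
  shows "(F has_derivative frechet_derivative F (at z)) (at z)"
    and "frechet_derivative F (at z) (c *s v) = c *s frechet_derivative F (at z) v"
proof -
  obtain L where "(F has_derivative L) (at z)" "\<forall>a v. L (a *s v) = a *s L v"
    using assms unfolding holomorphic_map_on_def by blast
  moreover from this have "L = frechet_derivative F (at z)"
    by (intro frechet_derivative_at)
  ultimately show "(F has_derivative frechet_derivative F (at z)) (at z)"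
    "frechet_derivative F (at z) (c *s v) = c *s frechet_derivative F (at z) v"
    by auto
qed

text \<open>Complex homogeneity of the differential turns the restriction of a component to a
  complex line into a holomorphic function of one variable, the setting of Cauchy's
  inequality.\<close>

lemma holomorphic_map_on_line:
  assumes F: "holomorphic_map_on F S" and "z + \<zeta> *s v \<in> S"
  shows "((\<lambda>\<zeta>. F (z + \<zeta> *s v) $ i) has_field_derivative
    frechet_derivative F (at (z + \<zeta> *s v)) v $ i) (at \<zeta>)"
proof -
  let ?D = "frechet_derivative F (at (z + \<zeta> *s v))"
  have "bounded_linear (\<lambda>\<zeta>. \<zeta> *s v)"
    by (rule linear_conv_bounded_linear[THEN iffD1], rule linearI)
      (simp_all add: vector_sadd_rdistrib vec_eq_iff)
  then have "((\<lambda>\<zeta>. z + \<zeta> *s v) has_derivative (\<lambda>h. h *s v)) (at \<zeta>)"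
    by (auto intro!: derivative_eq_intros bounded_linear_imp_has_derivative)
  from has_derivative_compose[OF this holomorphic_map_on_frechet(1)[OF assms]]
  have "((\<lambda>\<zeta>. F (z + \<zeta> *s v)) has_derivative (\<lambda>h. h *s ?D v)) (at \<zeta>)"
    by (simp add: holomorphic_map_on_frechet(2)[OF assms])
  from bounded_linear.has_derivative[OF bounded_linear_vec_nth this, of i]
  have "((\<lambda>\<zeta>. F (z + \<zeta> *s v) $ i) has_derivative (\<lambda>h. h * ?D v $ i)) (at \<zeta>)"
    by simp
  then show ?thesis
    unfolding has_field_derivative_def
    by (rule has_derivative_eq_rhs) (simp add: fun_eq_iff mult.commute)
qed

text \<open>Cauchy's inequality on the complex line through \<open>z\<close> in direction \<open>v\<close> turns the locally
  uniform continuity of \<open>F\<close> into continuity of its differential.\<close>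

lemma holomorphic_map_on_frechet_continuous:
  fixes F :: "complex ^ 'n::finite \<Rightarrow> complex ^ 'm::finite"
  assumes F: "holomorphic_map_on F S" and "open S"
  shows "continuous_on S (\<lambda>z. frechet_derivative F (at z) v)"
proof -
  have F_cont: "continuous_on S F"
    using holomorphic_map_on_frechet(1)[OF F] has_derivative_continuous
    by (blast intro: continuous_at_imp_continuous_on)
  have "((\<lambda>z. frechet_derivative F (at z) v $ i) \<longlongrightarrow> frechet_derivative F (at z0) v $ i) (at z0 within S)"
    if z0: "z0 \<in> S" for z0 i
  proof (rule tendstoI)
    fix e :: real assume "e > 0"
    obtain R where R: "R > 0" "cball z0 R \<subseteq> S"
      using \<open>open S\<close> z0 open_contains_cball by blast
    define r where "r = R / (2 * (1 + norm v))"
    have nv: "0 < 1 + norm v" by (simp add: add_pos_nonneg)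
    have r: "r > 0" "r * norm v \<le> R / 2"
    proof -
      show "r > 0" using R nv by (simp add: r_def)
      have "r * norm v \<le> r * (1 + norm v)" using \<open>r > 0\<close> by (intro mult_left_mono) auto
      also have "\<dots> = R / 2"
        using less_imp_neq[OF nv] unfolding r_def
        by (metis mult.commute nonzero_divide_mult_cancel_right times_divide_eq_right
          divide_divide_eq_left nonzero_mult_div_cancel_right)
      finally show "r * norm v \<le> R / 2" .
    qed
    have inS: "z + \<zeta> *s v \<in> cball z0 R" if "dist z z0 \<le> R / 2" "cmod \<zeta> \<le> r" for z \<zeta>
    proof -
      have "dist z0 (z + \<zeta> *s v) \<le> dist z0 z + norm (\<zeta> *s v)"
        using dist_triangle[of z0 "z + \<zeta> *s v" z] by (simp add: dist_norm)
      also have "norm (\<zeta> *s v) \<le> r * norm v"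
        unfolding norm_vector_smult using that by (intro mult_right_mono) auto
      finally show ?thesis using that r by (simp add: dist_commute)
    qed
    have "uniformly_continuous_on (cball z0 R) F"
      by (intro compact_uniformly_continuous continuous_on_subset[OF F_cont R(2)] compact_cball)
    \<comment> \<open>Cauchy's inequality on the circle of radius \<open>r\<close> divides by
      \<open>r\<close>, so the tolerance \<open>e * r / 2\<close> ends up as
      \<open>e / 2\<close>.\<close>
    then obtain d where d: "d > 0"
      "\<And>x y. x \<in> cball z0 R \<Longrightarrow> y \<in> cball z0 R \<Longrightarrow> dist y x < d \<Longrightarrow> dist (F y) (F x) < e * r / 2"
      unfolding uniformly_continuous_on_def using \<open>e > 0\<close> r by (metis half_gt_zero mult_pos_pos)
    have "dist (frechet_derivative F (at z) v $ i) (frechet_derivative F (at z0) v $ i) < e"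
      if z: "dist z z0 < min d (R / 2)" for z
    proof -
      \<comment> \<open>The difference of \<open>F\<close> along parallel complex lines through
        \<open>z\<close> and \<open>z0\<close>: small by uniform continuity, with derivative at 0
        equal to the difference of the differentials on \<open>v\<close>.\<close>
      define f where "f = (\<lambda>\<zeta>. F (z + \<zeta> *s v) $ i - F (z0 + \<zeta> *s v) $ i)"
      have fd: "(f has_field_derivative frechet_derivative F (at (z + \<zeta> *s v)) v $ i
          - frechet_derivative F (at (z0 + \<zeta> *s v)) v $ i) (at \<zeta>)" if "cmod \<zeta> \<le> r" for \<zeta>
        unfolding f_def using inS[of z \<zeta>] inS[of z0 \<zeta>] that z R r
        by (intro DERIV_diff holomorphic_map_on_line[OF F]) (auto simp: subset_iff)
      have "norm ((deriv ^^ 1) f 0) \<le> fact 1 * (e * r / 2) / r ^ 1"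
      proof (rule Cauchy_inequality)
        show "f holomorphic_on ball 0 r"
          unfolding holomorphic_on_def field_differentiable_def
          using fd by (meson has_field_derivative_at_within mem_ball_0 less_imp_le)
        show "continuous_on (cball 0 r) f"
          using fd by (intro continuous_at_imp_continuous_on ballI) (auto intro: DERIV_isCont)
        show "r > 0" by fact
        show "cmod (f \<zeta>) \<le> e * r / 2" if "cmod (0 - \<zeta>) = r" for \<zeta>
        proof -
          have "cmod (f \<zeta>) \<le> norm (F (z + \<zeta> *s v) - F (z0 + \<zeta> *s v))"
            unfolding f_def using Finite_Cartesian_Product.norm_nth_le[of "F (z + \<zeta> *s v) - F (z0 + \<zeta> *s v)" i] by simp
          also have "\<dots> < e * r / 2"
            unfolding dist_norm[symmetric] using inS[of z \<zeta>] inS[of z0 \<zeta>] z that R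
            by (intro d(2)) auto
          finally show ?thesis by simp
        qed
      qed
      moreover have "deriv f 0 = frechet_derivative F (at z) v $ i - frechet_derivative F (at z0) v $ i"
        using fd[of 0] r by (intro DERIV_imp_deriv) simp
      ultimately have "dist (frechet_derivative F (at z) v $ i) (frechet_derivative F (at z0) v $ i) \<le> e / 2"
        using r by (simp add: dist_norm)
      with \<open>e > 0\<close> show ?thesis by simp
    qed
    then show "\<forall>\<^sub>F z in at z0 within S. dist (frechet_derivative F (at z) v $ i) (frechet_derivative F (at z0) v $ i) < e"
      unfolding eventually_at using d(1) R(1) by (intro exI[of _ "min d (R / 2)"]) auto
  qed
  then show ?thesis
    unfolding continuous_on_def by (auto intro: vec_tendstoI)
qed

text \<open>Expanding the varying direction in the standard basis and using complex linearity
  reduces joint continuity to continuity for finitely many fixed directions.\<close>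

lemma holomorphic_map_on_frechet_continuous_along:
  fixes F :: "complex ^ 'n::finite \<Rightarrow> complex ^ 'm::finite"
  assumes F: "holomorphic_map_on F S" and "open S"
    and z: "continuous_on T z" "z ` T \<subseteq> S" and v: "continuous_on T v"
  shows "continuous_on T (\<lambda>x. frechet_derivative F (at (z x)) (v x))"
proof -
  have "frechet_derivative F (at (z x)) (v x) =
      (\<Sum>i\<in>UNIV. (v x $ i) *s frechet_derivative F (at (z x)) (axis i 1))" if "x \<in> T" for x
  proof -
    have zx: "z x \<in> S" using z that by auto
    then have "linear (frechet_derivative F (at (z x)))"
      using holomorphic_map_on_frechet(1)[OF F] has_derivative_linear by blast
    then have "frechet_derivative F (at (z x)) (\<Sum>i\<in>UNIV. (v x $ i) *s axis i 1) =
        (\<Sum>i\<in>UNIV. frechet_derivative F (at (z x)) ((v x $ i) *s axis i 1))"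
      by (rule linear_sum)
    then show ?thesis
      by (simp add: basis_expansion holomorphic_map_on_frechet(2)[OF F zx])
  qed
  moreover have "continuous_on T (\<lambda>x. \<Sum>i\<in>UNIV. (v x $ i) *s frechet_derivative F (at (z x)) (axis i 1))"
  proof -
    have D: "continuous_on T (\<lambda>x. frechet_derivative F (at (z x)) w)" for w
      using continuous_on_compose2[OF holomorphic_map_on_frechet_continuous[OF F \<open>open S\<close>] z] .
    have "continuous_on T (\<lambda>x. (\<Sum>i\<in>UNIV. (v x $ i) *s frechet_derivative F (at (z x)) (axis i 1)) $ j)" for j
      by (simp add: sum_component) (intro continuous_intros v D)
    then show ?thesis
      unfolding continuous_on_def by (auto intro!: vec_tendstoI)
  qed
  ultimately show ?thesis using continuous_on_cong[OF refl] by simp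
qed

section \<open>Curves and their velocities under change of charts\<close>

lemma complex_atlas_chart:
  assumes "complex_atlas A" "c \<in> A"
  shows "open (fst c)" "open (snd c ` fst c)" "continuous_on (fst c) (snd c)"
    "continuous_on (snd c ` fst c) (chart_inv c)" "p \<in> fst c \<Longrightarrow> chart_inv c (snd c p) = p"
    "d \<in> A \<Longrightarrow> holomorphic_map_on (transition c d) (snd c ` (fst c \<inter> fst d))"
    "d \<in> A \<Longrightarrow> open (snd c ` (fst c \<inter> fst d))"
proof -
  have hom: "homeomorphism (fst c) (snd c ` fst c) (snd c) (chart_inv c)"
    using assms unfolding complex_atlas_def by blast
  show o: "open (fst c)" "open (snd c ` fst c)"
    using assms unfolding complex_atlas_def by blast+
  show "continuous_on (fst c) (snd c)" "continuous_on (snd c ` fst c) (chart_inv c)"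
    "p \<in> fst c \<Longrightarrow> chart_inv c (snd c p) = p"
    using hom unfolding homeomorphism_def by auto
  show "d \<in> A \<Longrightarrow> holomorphic_map_on (transition c d) (snd c ` (fst c \<inter> fst d))"
    using assms unfolding complex_atlas_def by blast
  assume "d \<in> A"
  then have od: "open (fst d)" using assms unfolding complex_atlas_def by blast
  have "openin (top_of_set (snd c ` fst c)) (snd c ` (fst c \<inter> fst d))"
    by (rule homeomorphism_imp_open_map[OF hom]) (use od in \<open>simp add: openin_open_Int\<close>)
  then show "open (snd c ` (fst c \<inter> fst d))"
    using o(2) openin_open_trans by blast
qed

lemma chart_change_vector_derivative:
  assumes A: "complex_atlas A" "c \<in> A" "d \<in> A" and "t \<in> I" "0 < \<delta>"
    and c: "\<And>r. r \<in> I \<inter> ball t \<delta> \<Longrightarrow> \<gamma> r \<in> fst c" and d: "\<gamma> t \<in> fst d"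
    and v: "((\<lambda>r. snd c (\<gamma> r)) has_vector_derivative v) (at t within I)"
  shows "((\<lambda>r. snd d (\<gamma> r)) has_vector_derivative
    frechet_derivative (transition c d) (at (snd c (\<gamma> t))) v) (at t within I)"
proof -
  let ?D = "frechet_derivative (transition c d) (at (snd c (\<gamma> t)))"
  have "snd c (\<gamma> t) \<in> snd c ` (fst c \<inter> fst d)"
    using c[of t] d \<open>t \<in> I\<close> \<open>0 < \<delta>\<close> by auto
  then have D: "(transition c d has_derivative ?D) (at (snd c (\<gamma> t)))"
    by (rule holomorphic_map_on_frechet(1)[OF complex_atlas_chart(6)[OF A]])
  have "((\<lambda>r. transition c d (snd c (\<gamma> r))) has_derivative (\<lambda>h. ?D (h *\<^sub>R v))) (at t within I)"
    by (rule has_derivative_compose[OF v[unfolded has_vector_derivative_def] D])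
  then have "((\<lambda>r. transition c d (snd c (\<gamma> r))) has_vector_derivative ?D v) (at t within I)"
    unfolding has_vector_derivative_def
    by (simp add: linear_cmul[OF has_derivative_linear[OF D]])
  then show ?thesis
    by (rule has_vector_derivative_transform_within[OF _ \<open>0 < \<delta>\<close> \<open>t \<in> I\<close>])
      (use c in \<open>auto simp: transition_def complex_atlas_chart(5)[OF A(1,2)] dist_commute\<close>)
qed

text \<open>Continuity of the curve in the manifold at \<open>t\<close> is recovered from
  differentiability in one chart by composing with the continuous
  \<open>chart_inv c\<close>.\<close>

lemma curve_eventually_in_chart:
  assumes A: "complex_atlas A" "c \<in> A" "d \<in> A" and "t \<in> I" "0 < \<delta>"
    and c: "\<And>r. r \<in> I \<inter> ball t \<delta> \<Longrightarrow> \<gamma> r \<in> fst c" and d: "\<gamma> t \<in> fst d"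
    and v: "((\<lambda>r. snd c (\<gamma> r)) has_vector_derivative v) (at t within I)"
  shows "\<exists>\<epsilon>>0. \<forall>r\<in>I \<inter> ball t \<epsilon>. \<gamma> r \<in> fst d"
proof -
  have ct: "snd c (\<gamma> t) \<in> snd c ` fst c" "\<gamma> t \<in> fst c" using c[of t] \<open>t \<in> I\<close> \<open>0 < \<delta>\<close> by auto
  have "isCont (chart_inv c) (snd c (\<gamma> t))"
    using complex_atlas_chart(2,4)[OF A(1,2)] ct(1) continuous_on_eq_continuous_at by blast
  moreover have "((\<lambda>r. snd c (\<gamma> r)) \<longlongrightarrow> snd c (\<gamma> t)) (at t within I)"
    using has_vector_derivative_continuous[OF v] by (simp add: continuous_within)
  ultimately have "((\<lambda>r. chart_inv c (snd c (\<gamma> r))) \<longlongrightarrow> chart_inv c (snd c (\<gamma> t))) (at t within I)"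
    by (rule isCont_tendsto_compose)
  then have "((\<lambda>r. chart_inv c (snd c (\<gamma> r))) \<longlongrightarrow> \<gamma> t) (at t within I)"
    by (simp add: complex_atlas_chart(5)[OF A(1,2) ct(2)])
  from topological_tendstoD[OF this complex_atlas_chart(1)[OF A(1,3)] d]
  obtain \<epsilon> where \<epsilon>: "\<epsilon> > 0"
    "\<And>r. r \<in> I \<Longrightarrow> r \<noteq> t \<Longrightarrow> dist r t < \<epsilon> \<Longrightarrow> chart_inv c (snd c (\<gamma> r)) \<in> fst d"
    unfolding eventually_at by auto
  have "\<gamma> r \<in> fst d" if r: "r \<in> I \<inter> ball t (min \<delta> \<epsilon>)" for r
  proof (cases "r = t")
    case False
    have "\<gamma> r \<in> fst c" using c[of r] r by auto
    moreover have "chart_inv c (snd c (\<gamma> r)) \<in> fst d"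
      by (rule \<epsilon>(2)) (use r False in \<open>auto simp: dist_commute\<close>)
    ultimately show ?thesis by (simp add: complex_atlas_chart(5)[OF A(1,2)])
  qed (use d in auto)
  then show ?thesis using \<epsilon>(1) \<open>0 < \<delta>\<close> by (intro exI[of _ "min \<delta> \<epsilon>"]) auto
qed

text \<open>\<open>velocity\<close> takes a derivative separately in each chart. Differentiability
  in a single chart spreads to all others by the chain rule, and the nontrivial filter makes the
  derivatives unique, so the coordinates fit together.\<close>

lemma velocity_chart:
  assumes A: "complex_atlas A" "c \<in> A" and nb: "at t within I \<noteq> bot" and t: "t \<in> I" "0 < \<delta>"
    and c: "\<And>r. r \<in> I \<inter> ball t \<delta> \<Longrightarrow> \<gamma> r \<in> fst c"
    and v: "((\<lambda>r. snd c (\<gamma> r)) has_vector_derivative v) (at t within I)"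
  shows "velocity A I \<gamma> t \<in> tangent_space A (\<gamma> t)"
    and "velocity A I \<gamma> t c = v"
    and "chart_at A (\<gamma> t) d \<Longrightarrow>
      ((\<lambda>r. snd d (\<gamma> r)) has_vector_derivative velocity A I \<gamma> t d) (at t within I)"
    and "chart_at A (\<gamma> t) d \<Longrightarrow>
      velocity A I \<gamma> t d = frechet_derivative (transition c d) (at (snd c (\<gamma> t))) v"
proof -
  have vel: "velocity A I \<gamma> t d = w"
    if "chart_at A (\<gamma> t) d" "((\<lambda>r. snd d (\<gamma> r)) has_vector_derivative w) (at t within I)" for d w
    unfolding velocity_def using that vector_derivative_within[OF nb that(2)] by simp
  have trans: "((\<lambda>r. snd d (\<gamma> r)) has_vector_derivative
      frechet_derivative (transition c d) (at (snd c (\<gamma> t))) v) (at t within I)"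
    if "chart_at A (\<gamma> t) d" for d
    using that by (intro chart_change_vector_derivative[OF A _ t c _ v]) (auto simp: chart_at_def)
  have D: "((\<lambda>r. snd d (\<gamma> r)) has_vector_derivative velocity A I \<gamma> t d) (at t within I)"
    if "chart_at A (\<gamma> t) d" for d
    using vel[OF that trans[OF that]] trans[OF that] by simp
  have "\<gamma> t \<in> fst c" using c[of t] t by auto
  then have cc: "chart_at A (\<gamma> t) c" using A by (simp add: chart_at_def)
  show "velocity A I \<gamma> t c = v" by (rule vel[OF cc v])
  show "chart_at A (\<gamma> t) d \<Longrightarrow>
      ((\<lambda>r. snd d (\<gamma> r)) has_vector_derivative velocity A I \<gamma> t d) (at t within I)"
    by (rule D)
  show "chart_at A (\<gamma> t) d \<Longrightarrow>
      velocity A I \<gamma> t d = frechet_derivative (transition c d) (at (snd c (\<gamma> t))) v"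
    by (rule vel[OF _ trans])
  show "velocity A I \<gamma> t \<in> tangent_space A (\<gamma> t)"
    unfolding tangent_space_def
  proof (intro CollectI conjI allI impI)
    show "velocity A I \<gamma> t d = 0" if "\<not> chart_at A (\<gamma> t) d" for d
      using that by (simp add: velocity_def)
    fix d e assume d: "chart_at A (\<gamma> t) d" and e: "chart_at A (\<gamma> t) e"
    then have dA: "d \<in> A" "\<gamma> t \<in> fst d" "e \<in> A" "\<gamma> t \<in> fst e" by (auto simp: chart_at_def)
    \<comment> \<open>The chain rule is now applied from \<open>d\<close> to \<open>e\<close>, which
      requires the curve to stay in the domain of \<open>d\<close> near \<open>t\<close>.\<close>
    obtain \<epsilon> where \<epsilon>: "\<epsilon> > 0" "\<forall>r\<in>I \<inter> ball t \<epsilon>. \<gamma> r \<in> fst d"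
      using curve_eventually_in_chart[OF A dA(1) t c dA(2) v] by blast
    show "velocity A I \<gamma> t e =
        frechet_derivative (transition d e) (at (snd d (\<gamma> t))) (velocity A I \<gamma> t d)"
      by (rule vel[OF e chart_change_vector_derivative[OF A(1) dA(1,3) t(1) \<epsilon>(1) _ dA(4) D[OF d]]])
        (use \<epsilon>(2) in blast)
  qed
qed

lemma tangent_space_eqI:
  assumes "v \<in> tangent_space A p" "w \<in> tangent_space A p" "chart_at A p c" "v c = w c"
  shows "v = w"
proof
  fix d
  show "v d = w d"
  proof (cases "chart_at A p d")
    case True
    then have "v d = frechet_derivative (transition c d) (at (snd c p)) (v c)"
      "w d = frechet_derivative (transition c d) (at (snd c p)) (w c)"
      using assms unfolding tangent_space_def by blast+
    then show ?thesis using assms(4) by simp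
  next
    case False
    then have "v d = 0" "w d = 0"
      using assms unfolding tangent_space_def by blast+
    then show ?thesis by simp
  qed
qed

section \<open>Velocities of paths in the loop space\<close>

text \<open>By Fatou's lemma the squared \<open>L^2\<close> distance of \<open>w\<close> and
  \<open>\<xi>\<close> is at most the limit inferior of those of \<open>f n\<close> and
  \<open>\<xi>\<close>, hence 0. Continuity of both turns this into equality at every point,
  endpoints included.\<close>

lemma L2_limit_eq_pointwise_limit:
  fixes f :: "nat \<Rightarrow> real \<Rightarrow> 'e::euclidean_space"
  assumes "\<alpha> < \<beta>" and f: "\<And>n. continuous_on {\<alpha>..\<beta>} (f n)"
    and w: "continuous_on {\<alpha>..\<beta>} w" and \<xi>: "continuous_on {\<alpha>..\<beta>} \<xi>"
    and pointwise: "\<And>x. x \<in> {\<alpha>..\<beta>} \<Longrightarrow> (\<lambda>n. f n x) \<longlonglongrightarrow> w x"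
    and L2: "(\<lambda>n. LINT x:{\<alpha>..\<beta>}|lborel. (norm (f n x - \<xi> x))\<^sup>2) \<longlonglongrightarrow> 0"
    and "x \<in> {\<alpha>..\<beta>}"
  shows "w x = \<xi> x"
proof -
  let ?g = "\<lambda>f x. indicat_real {\<alpha>..\<beta>} x *\<^sub>R (norm (f x - \<xi> x))\<^sup>2"
  have int: "integrable lborel (?g f)" if "continuous_on {\<alpha>..\<beta>} f" for f
  proof -
    have "continuous_on {\<alpha>..\<beta>} (\<lambda>x. (norm (f x - \<xi> x))\<^sup>2)"
      by (intro continuous_intros that \<xi>)
    from borel_integrable_atLeastAtMost'[OF this] show ?thesis
      unfolding set_integrable_def .
  qed
  have nn: "(\<integral>\<^sup>+x. ennreal (?g f x) \<partial>lborel) = ennreal (LINT x:{\<alpha>..\<beta>}|lborel. (norm (f x - \<xi> x))\<^sup>2)"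
    if "continuous_on {\<alpha>..\<beta>} f" for f
    unfolding set_lebesgue_integral_def by (intro nn_integral_eq_integral int that) auto
  have lim: "(\<lambda>n. ennreal (?g (f n) x)) \<longlonglongrightarrow> ennreal (?g w x)" for x
    by (cases "x \<in> {\<alpha>..\<beta>}") (auto intro!: tendsto_intros pointwise)
  have "(\<integral>\<^sup>+x. ennreal (?g w x) \<partial>lborel) = (\<integral>\<^sup>+x. liminf (\<lambda>n. ennreal (?g (f n) x)) \<partial>lborel)"
    by (intro nn_integral_cong lim_imp_Liminf[symmetric] lim) simp
  also have "\<dots> \<le> liminf (\<lambda>n. \<integral>\<^sup>+x. ennreal (?g (f n) x) \<partial>lborel)"
    using borel_measurable_integrable[OF int[OF f]] by (intro nn_integral_liminf) simp
  also have "\<dots> = liminf (\<lambda>n. ennreal (LINT x:{\<alpha>..\<beta>}|lborel. (norm (f n x - \<xi> x))\<^sup>2))"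
    by (simp only: nn[OF f])
  also have "\<dots> = ennreal 0"
    by (intro lim_imp_Liminf tendsto_ennrealI L2) simp
  finally have "(LINT x:{\<alpha>..\<beta>}|lborel. (norm (w x - \<xi> x))\<^sup>2) \<le> 0"
    unfolding nn[OF w] by (simp add: ennreal_eq_0_iff)
  then have "(LINT x:{\<alpha>..\<beta>}|lborel. (norm (w x - \<xi> x))\<^sup>2) = 0"
    using set_integral_power2_norm_nonneg[of \<alpha> \<beta> "\<lambda>x. w x - \<xi> x"] by linarith
  moreover have "(LINT x:{\<alpha>..\<beta>}|lborel. (norm (w x - \<xi> x))\<^sup>2) = integral {\<alpha>..\<beta>} (\<lambda>x. (norm (w x - \<xi> x))\<^sup>2)"
    by (intro set_borel_integral_eq_integral borel_integrable_atLeastAtMost' continuous_intros w \<xi>)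
  moreover have "continuous_on {\<alpha>..\<beta>} (\<lambda>x. (norm (w x - \<xi> x))\<^sup>2)"
    by (intro continuous_intros w \<xi>)
  ultimately have "\<forall>x\<in>{\<alpha>..\<beta>}. (norm (w x - \<xi> x))\<^sup>2 = 0"
    using integral_eq_0_iff[of \<alpha> \<beta> "\<lambda>x. (norm (w x - \<xi> x))\<^sup>2"] \<open>\<alpha> < \<beta>\<close> by simp
  then show ?thesis using \<open>x \<in> {\<alpha>..\<beta>}\<close> by auto
qed

text \<open>One chart, one arc and one time radius serve all properties at once, a uniformity that
  separate existence statements would lose.\<close>

definition velocity_arc ::
    "nat \<Rightarrow> nat \<Rightarrow> ('x, 'n::finite) chart set \<Rightarrow> real set \<Rightarrow> (real \<Rightarrow> complex \<Rightarrow> 'x) \<Rightarrow> real \<Rightarrow> real \<Rightarrow>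
     ('x, 'n) chart \<Rightarrow> real \<Rightarrow> real \<Rightarrow> real \<Rightarrow> bool" where
  "velocity_arc m k A I \<gamma> t \<theta> c a b \<delta> \<longleftrightarrow> c \<in> A \<and> 0 < \<delta> \<and> a < \<theta> \<and> \<theta> < b \<and>
     (\<forall>r\<in>I \<inter> ball t \<delta>. arc_in_chart c a b (\<gamma> r) \<and>
        sobolev k a b (\<lambda>x. snd c (\<gamma> r (cis x))) \<and>
        sobolev_has_derivative k a b (\<lambda>r x. snd c (\<gamma> r (cis x)))
          (\<lambda>v x. v *\<^sub>R velocity A I (\<lambda>r. \<gamma> r (cis x)) r c) r (I \<inter> ball t \<delta>) \<and>
        (\<forall>x\<in>{a..b}. velocity A I (\<lambda>r. \<gamma> r (cis x)) r \<in> tangent_space A (\<gamma> r (cis x)) \<and>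
          ((\<lambda>r. snd c (\<gamma> r (cis x))) has_vector_derivative
            velocity A I (\<lambda>r. \<gamma> r (cis x)) r c) (at r within I))) \<and>
     sobolev_Ck m k a b (\<lambda>r x. velocity A I (\<lambda>r. \<gamma> r (cis x)) r c) (I \<inter> ball t \<delta>)"

lemma loop_smooth_velocity_arc:
  fixes A :: "('x::{t2_space, second_countable_topology}, 'n::finite) chart set"
  assumes A: "complex_atlas A" and "k \<ge> 1" and nb: "\<And>t. t \<in> I \<Longrightarrow> at t within I \<noteq> bot"
    and smooth: "loop_smooth (Suc m) k A I \<gamma>" and "t \<in> I"
  shows "\<exists>c a b \<delta>. velocity_arc m k A I \<gamma> t \<theta> c a b \<delta>"
proof -
  let ?u = "\<lambda>c r x. snd c (\<gamma> r (cis x))"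
  obtain c a b \<delta> where c: "c \<in> A" "0 < \<delta>" "a < \<theta>" "\<theta> < b"
    and arc: "\<And>r. r \<in> I \<inter> ball t \<delta> \<Longrightarrow> arc_in_chart c a b (\<gamma> r)"
    and Ck: "sobolev_Ck (Suc m) k a b (?u c) (I \<inter> ball t \<delta>)"
    using smooth \<open>t \<in> I\<close> unfolding loop_smooth_def by metis
  let ?S = "I \<inter> ball t \<delta>"
  let ?v = "\<lambda>r x. velocity A I (\<lambda>r. \<gamma> r (cis x)) r"
  have "a < b" using c by simp
  have sob: "sobolev k a b (?u c r)" if "r \<in> ?S" for r
    using sobolev_Ck_sobolev[OF Ck that] .
  obtain u' where u': "\<And>r. r \<in> ?S \<Longrightarrow> sobolev_has_derivative k a b (?u c) (u' r) r ?S"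
    "\<And>v. sobolev_Ck m k a b (\<lambda>r. u' r v) ?S"
    using Ck unfolding sobolev_Ck.simps(2) by blast
  have D: "((\<lambda>r. ?u c r x) has_vector_derivative u' r 1 x) (at r within I)"
    if r: "r \<in> ?S" and x: "x \<in> {a..b}" for r x
  proof -
    have "at r within I = at r within ?S"
      by (rule at_within_nhd[of _ "ball t \<delta>"]) (use r in auto)
    then show ?thesis
      using sobolev_has_derivative_pointwise[OF \<open>a < b\<close> \<open>k \<ge> 1\<close> sob u'(1)[OF r] r x] by simp
  qed
  have vel: "?v r x \<in> tangent_space A (\<gamma> r (cis x))" "?v r x c = u' r 1 x"
    if r: "r \<in> ?S" and x: "x \<in> {a..b}" for r x
  proof -
    \<comment> \<open>\<open>velocity_chart\<close> wants a ball centered at the current time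
      \<open>r\<close>, whereas the arc data live on a ball around \<open>t\<close>.\<close>
    obtain \<epsilon> where \<epsilon>: "\<epsilon> > 0" "ball r \<epsilon> \<subseteq> ball t \<delta>"
      using r open_contains_ball[of "ball t \<delta>"] by (metis IntD2 open_ball)
    have "r \<in> I" using r by simp
    have near: "\<gamma> q (cis x) \<in> fst c" if "q \<in> I \<inter> ball r \<epsilon>" for q
    proof -
      have "q \<in> ?S" using that \<epsilon>(2) by blast
      then show ?thesis using arc[of q] x unfolding arc_in_chart_def by blast
    qed
    show "?v r x \<in> tangent_space A (\<gamma> r (cis x))" "?v r x c = u' r 1 x"
      using velocity_chart(1,2)[OF A c(1) nb[OF \<open>r \<in> I\<close>] \<open>r \<in> I\<close> \<epsilon>(1), of "\<lambda>r. \<gamma> r (cis x)", OF near D[OF r x]]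
      by simp_all
  qed
  have "sobolev_has_derivative k a b (?u c) (\<lambda>v x. v *\<^sub>R ?v r x c) r ?S" if r: "r \<in> ?S" for r
  proof -
    have "u' r v x = v *\<^sub>R ?v r x c" if "x \<in> {a..b}" for v x
      using sobolev_has_derivative_scaleR[OF u'(1)[OF r] that, of v] vel(2)[OF r that] by simp
    then show ?thesis
      using sobolev_has_derivative_cong[OF r, of a b "?u c" "?u c" "u' r" "\<lambda>v x. v *\<^sub>R ?v r x c" k] u'(1)[OF r]
      by simp
  qed
  moreover have "sobolev_Ck m k a b (\<lambda>r x. ?v r x c) ?S"
    using sobolev_Ck_cong[of ?S a b "\<lambda>r. u' r 1" "\<lambda>r x. ?v r x c" m k] u'(2)[of 1] vel(2) by simp
  moreover have "((\<lambda>r. ?u c r x) has_vector_derivative ?v r x c) (at r within I)"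
    if "r \<in> ?S" "x \<in> {a..b}" for r x
    using D[OF that] vel(2)[OF that] by simp
  ultimately have "velocity_arc m k A I \<gamma> t \<theta> c a b \<delta>"
    unfolding velocity_arc_def using c arc sob vel(1) by (intro conjI ballI)
  then show ?thesis by blast
qed

text \<open>The value off the circle is the one prescribed by \<open>tangent_loops\<close>, so that
  it can equal \<open>loop_velocity\<close> as a function on the whole plane.\<close>

definition pointwise_velocity ::
    "('x, 'n::finite) chart set \<Rightarrow> real set \<Rightarrow> (real \<Rightarrow> complex \<Rightarrow> 'x) \<Rightarrow> real \<Rightarrow> complex \<Rightarrow> ('x, 'n) tvec" where
  "pointwise_velocity A I \<gamma> t s = (if s \<in> S1 then velocity A I (\<lambda>r. \<gamma> r s) t else (\<lambda>c. 0))"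

lemma pointwise_velocity_cis [simp]:
  "pointwise_velocity A I \<gamma> t (cis x) = velocity A I (\<lambda>r. \<gamma> r (cis x)) t"
  by (simp add: pointwise_velocity_def)

lemma sphere_cis_cases:
  assumes "s \<in> S1"
  obtains \<theta> where "s = cis \<theta>"
proof -
  have n: "norm s = 1" using assms by simp
  then have "cis (Arg s) = sgn s" by (intro cis_Arg) auto
  also have "\<dots> = s" by (simp add: sgn_div_norm n)
  finally show thesis using that by metis
qed

lemma pointwise_velocity_tangent_loops:
  fixes A :: "('x::{t2_space, second_countable_topology}, 'n::finite) chart set"
  assumes A: "complex_atlas A" and "k \<ge> 1" and nb: "\<And>t. t \<in> I \<Longrightarrow> at t within I \<noteq> bot"
    and smooth: "loop_smooth (Suc m) k A I \<gamma>" and "t \<in> I"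
  shows "pointwise_velocity A I \<gamma> t \<in> tangent_loops k A (\<gamma> t)"
  unfolding tangent_loops_def
proof (intro CollectI conjI ballI allI impI)
  fix s assume "s \<in> S1"
  then obtain \<theta> where s: "s = cis \<theta>" by (rule sphere_cis_cases)
  obtain c a b \<delta> where V: "velocity_arc m k A I \<gamma> t \<theta> c a b \<delta>"
    using loop_smooth_velocity_arc[OF assms] by blast
  then have "t \<in> I \<inter> ball t \<delta>" "\<theta> \<in> {a..b}"
    using \<open>t \<in> I\<close> by (auto simp: velocity_arc_def)
  with V show "pointwise_velocity A I \<gamma> t s \<in> tangent_space A (\<gamma> t s)"
    unfolding velocity_arc_def s pointwise_velocity_cis by blast
next
  fix \<theta>
  obtain c a b \<delta> where V: "velocity_arc m k A I \<gamma> t \<theta> c a b \<delta>"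
    using loop_smooth_velocity_arc[OF assms] by blast
  then have t: "t \<in> I \<inter> ball t \<delta>"
    using \<open>t \<in> I\<close> by (auto simp: velocity_arc_def)
  have "sobolev_Ck m k a b (\<lambda>r x. velocity A I (\<lambda>r. \<gamma> r (cis x)) r c) (I \<inter> ball t \<delta>)"
    using V unfolding velocity_arc_def by blast
  from sobolev_Ck_sobolev[OF this t] V t
  show "\<exists>c\<in>A. \<exists>a b. a < \<theta> \<and> \<theta> < b \<and> arc_in_chart c a b (\<gamma> t) \<and>
      sobolev k a b (\<lambda>x. pointwise_velocity A I \<gamma> t (cis x) c)"
    unfolding velocity_arc_def pointwise_velocity_cis by blast
qed (simp add: pointwise_velocity_def)

lemma has_loop_velocity_pointwise_velocity:
  fixes A :: "('x::{t2_space, second_countable_topology}, 'n::finite) chart set"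
  assumes A: "complex_atlas A" and "k \<ge> 1" and nb: "\<And>t. t \<in> I \<Longrightarrow> at t within I \<noteq> bot"
    and smooth: "loop_smooth (Suc m) k A I \<gamma>" and "t \<in> I"
  shows "has_loop_velocity k A I \<gamma> t (pointwise_velocity A I \<gamma> t)"
  unfolding has_loop_velocity_def
proof (intro conjI allI)
  show "pointwise_velocity A I \<gamma> t \<in> tangent_loops k A (\<gamma> t)"
    by (rule pointwise_velocity_tangent_loops[OF assms])
  fix \<theta>
  obtain c a b \<delta> where V: "velocity_arc m k A I \<gamma> t \<theta> c a b \<delta>"
    using loop_smooth_velocity_arc[OF assms] by blast
  then have "t \<in> I \<inter> ball t \<delta>"
    using \<open>t \<in> I\<close> by (auto simp: velocity_arc_def)
  with V show "\<exists>c\<in>A. \<exists>a b. \<exists>\<delta>>0. a < \<theta> \<and> \<theta> < b \<and>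
        (\<forall>r\<in>I \<inter> ball t \<delta>. arc_in_chart c a b (\<gamma> r)) \<and>
        sobolev_has_derivative k a b (\<lambda>r x. snd c (\<gamma> r (cis x)))
          (\<lambda>v x. v *\<^sub>R pointwise_velocity A I \<gamma> t (cis x) c) t (I \<inter> ball t \<delta>)"
    unfolding velocity_arc_def pointwise_velocity_cis by blast
qed

lemma loop_field_pointwise_velocity:
  fixes A :: "('x::{t2_space, second_countable_topology}, 'n::finite) chart set"
  assumes A: "complex_atlas A" and "k \<ge> 1" and nb: "\<And>t. t \<in> I \<Longrightarrow> at t within I \<noteq> bot"
    and smooth: "loop_smooth (Suc m) k A I \<gamma>"
  shows "loop_field m k A I \<gamma> (pointwise_velocity A I \<gamma>)"
  unfolding loop_field_def
proof (intro conjI allI ballI)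
  show "pointwise_velocity A I \<gamma> t \<in> tangent_loops k A (\<gamma> t)" if "t \<in> I" for t
    by (rule pointwise_velocity_tangent_loops[OF assms that])
  fix t \<theta> assume "t \<in> I"
  obtain c a b \<delta> where V: "velocity_arc m k A I \<gamma> t \<theta> c a b \<delta>"
    using loop_smooth_velocity_arc[OF assms \<open>t \<in> I\<close>] by blast
  then show "\<exists>c\<in>A. \<exists>a b. \<exists>\<delta>>0. a < \<theta> \<and> \<theta> < b \<and>
        (\<forall>r\<in>I \<inter> ball t \<delta>. arc_in_chart c a b (\<gamma> r)) \<and>
        sobolev_Ck m k a b (\<lambda>r x. pointwise_velocity A I \<gamma> r (cis x) c) (I \<inter> ball t \<delta>)"
    unfolding velocity_arc_def pointwise_velocity_cis by blast
qed

lemma tangent_loops_eqI: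
  assumes "\<xi> \<in> tangent_loops k A g" "\<eta> \<in> tangent_loops k A g"
    and eq: "\<And>\<theta>. \<exists>c. chart_at A (g (cis \<theta>)) c \<and> \<xi> (cis \<theta>) c = \<eta> (cis \<theta>) c"
  shows "\<xi> = \<eta>"
proof
  fix s
  show "\<xi> s = \<eta> s"
  proof (cases "s \<in> S1")
    case True
    then obtain \<theta> where s: "s = cis \<theta>" by (rule sphere_cis_cases)
    obtain c where "chart_at A (g s) c" "\<xi> s c = \<eta> s c" using eq[of \<theta>] s by blast
    moreover have "\<xi> s \<in> tangent_space A (g s)" "\<eta> s \<in> tangent_space A (g s)"
      using assms(1,2) True unfolding tangent_loops_def by blast+
    ultimately show ?thesis by (intro tangent_space_eqI)
  next
    case False
    then have "\<xi> s = (\<lambda>c. 0)" "\<eta> s = (\<lambda>c. 0)"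
      using assms(1,2) unfolding tangent_loops_def by blast+
    then show ?thesis by simp
  qed
qed

lemma has_vector_derivative_difference_quotient:
  assumes "(f has_vector_derivative D) (at t within S)"
  shows "((\<lambda>r. (f r - f t) /\<^sub>R (r - t)) \<longlongrightarrow> D) (at t within S)"
proof (rule Lim_null[THEN iffD2], rule tendsto_norm_zero_cancel)
  have "((\<lambda>r. norm (f r - f t - (r - t) *\<^sub>R D) / norm (r - t)) \<longlongrightarrow> 0) (at t within S)"
    using assms unfolding has_vector_derivative_def has_derivative_iff_norm by blast
  then show "((\<lambda>r. norm ((f r - f t) /\<^sub>R (r - t) - D)) \<longlongrightarrow> 0) (at t within S)"
  proof (rule Lim_transform_eventually)
    show "\<forall>\<^sub>F r in at t within S. norm (f r - f t - (r - t) *\<^sub>R D) / norm (r - t) =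
        norm ((f r - f t) /\<^sub>R (r - t) - D)"
      unfolding eventually_at_filter
    proof (intro always_eventually allI impI)
      fix r assume "r \<noteq> t"
      then have "(f r - f t) /\<^sub>R (r - t) - D = (f r - f t - (r - t) *\<^sub>R D) /\<^sub>R (r - t)"
        by (simp add: scaleR_diff_right)
      then show "norm (f r - f t - (r - t) *\<^sub>R D) / norm (r - t) = norm ((f r - f t) /\<^sub>R (r - t) - D)"
        by (simp add: divide_inverse mult.commute)
    qed
  qed
qed

lemma loop_chart_continuous:
  assumes A: "complex_atlas A" "c \<in> A" and "g \<in> loop_space k A" "arc_in_chart c a b g"
  shows "continuous_on {a..b} (\<lambda>x. snd c (g (cis x)))"
proof -
  have "continuous_on S1 g" using assms by (simp add: loop_space_def)
  then have "continuous_on {a..b} (\<lambda>x. g (cis x))"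
    by (rule continuous_on_compose2) (auto intro!: continuous_intros)
  then show ?thesis
    by (rule continuous_on_compose2[OF complex_atlas_chart(3)[OF A]])
      (use assms(4) in \<open>auto simp: arc_in_chart_def\<close>)
qed

text \<open>A chart in which \<open>\<xi>\<close> is tested need not be one in which the
  arcs of \<open>\<gamma>\<close> are known to be Sobolev, so only the \<open>L\<^sup>2\<close> part of \<open>sobolev_norm\<close>
  is usable there: the difference quotients tend to \<open>\<xi>\<close> in \<open>L\<^sup>2\<close> and to the pointwise velocity
  everywhere, and both limits are continuous along the arc.\<close>

lemma has_loop_velocity_unique:
  fixes A :: "('x::{t2_space, second_countable_topology}, 'n::finite) chart set"
  assumes A: "complex_atlas A" and "k \<ge> 1" and nb: "\<And>t. t \<in> I \<Longrightarrow> at t within I \<noteq> bot"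
    and smooth: "loop_smooth (Suc m) k A I \<gamma>" and "t \<in> I"
    and \<xi>: "has_loop_velocity k A I \<gamma> t \<xi>"
  shows "\<xi> = pointwise_velocity A I \<gamma> t"
proof (rule tangent_loops_eqI)
  show \<xi>_tangent: "\<xi> \<in> tangent_loops k A (\<gamma> t)" using \<xi> by (simp add: has_loop_velocity_def)
  show "pointwise_velocity A I \<gamma> t \<in> tangent_loops k A (\<gamma> t)"
    by (rule pointwise_velocity_tangent_loops[OF assms(1-5)])
  fix \<theta>
  obtain d a' b' \<delta>' where d: "d \<in> A" "\<delta>' > 0" "a' < \<theta>" "\<theta> < b'"
    and arc': "\<And>r. r \<in> I \<inter> ball t \<delta>' \<Longrightarrow> arc_in_chart d a' b' (\<gamma> r)"
    and D': "sobolev_has_derivative k a' b' (\<lambda>r x. snd d (\<gamma> r (cis x)))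
          (\<lambda>v x. v *\<^sub>R \<xi> (cis x) d) t (I \<inter> ball t \<delta>')"
    using \<xi> unfolding has_loop_velocity_def by blast
  obtain c a b \<delta> where V: "velocity_arc m k A I \<gamma> t \<theta> c a b \<delta>"
    using loop_smooth_velocity_arc[OF assms(1-5)] by blast
  then have c: "c \<in> A" "\<delta> > 0" "a < \<theta>" "\<theta> < b"
    and Vt: "\<And>r. r \<in> I \<inter> ball t \<delta> \<Longrightarrow> arc_in_chart c a b (\<gamma> r)"
    unfolding velocity_arc_def by blast+
  let ?S = "I \<inter> ball t \<delta>'"
  have tS: "t \<in> ?S" "t \<in> I \<inter> ball t \<delta>" using \<open>t \<in> I\<close> c d by auto
  let ?v = "\<lambda>x. velocity A I (\<lambda>r. \<gamma> r (cis x)) t"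
  have D: "((\<lambda>r. snd c (\<gamma> r (cis x))) has_vector_derivative ?v x c) (at t within I)"
    if "x \<in> {a..b}" for x
    using V tS(2) that unfolding velocity_arc_def by blast
  have sob: "sobolev k a b (\<lambda>x. snd c (\<gamma> t (cis x)))"
    using V tS(2) unfolding velocity_arc_def by blast
  have Ck: "sobolev_Ck m k a b (\<lambda>r x. velocity A I (\<lambda>r. \<gamma> r (cis x)) r c) (I \<inter> ball t \<delta>)"
    using V unfolding velocity_arc_def by blast
  have sobv: "sobolev k a b (\<lambda>x. ?v x c)"
    using sobolev_Ck_sobolev[OF Ck tS(2)] .
  \<comment> \<open>The common part of the arc known to be Sobolev in chart \<open>c\<close> and the
    arc on which \<open>\<xi>\<close> is tested in chart \<open>d\<close>; it still has
    \<open>\<theta>\<close> in its interior.\<close>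
  define \<alpha> \<beta> where "\<alpha> = max a a'" and "\<beta> = min b b'"
  have \<alpha>\<beta>: "\<alpha> < \<theta>" "\<theta> < \<beta>" "{\<alpha>..\<beta>} \<subseteq> {a..b}" "{\<alpha>..\<beta>} \<subseteq> {a'..b'}"
    using c d by (auto simp: \<alpha>_def \<beta>_def)
  have cd: "\<gamma> t (cis x) \<in> fst c" "\<gamma> t (cis x) \<in> fst d" if "x \<in> {\<alpha>..\<beta>}" for x
    using Vt[OF tS(2)] arc'[OF tS(1)] \<alpha>\<beta>(3,4) that unfolding arc_in_chart_def by blast+
  have near: "\<gamma> r (cis x) \<in> fst c" if "x \<in> {\<alpha>..\<beta>}" "r \<in> I \<inter> ball t \<delta>" for x r
    using Vt[OF that(2)] \<alpha>\<beta>(3) that(1) unfolding arc_in_chart_def by blast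
  have chd: "chart_at A (\<gamma> t (cis x)) d" if "x \<in> {\<alpha>..\<beta>}" for x
    using d(1) cd(2)[OF that] by (simp add: chart_at_def)
  have Dd: "((\<lambda>r. snd d (\<gamma> r (cis x))) has_vector_derivative ?v x d) (at t within I)"
    and vd: "?v x d = frechet_derivative (transition c d) (at (snd c (\<gamma> t (cis x)))) (?v x c)"
    if x: "x \<in> {\<alpha>..\<beta>}" for x
  proof -
    have "x \<in> {a..b}" using x \<alpha>\<beta> by blast
    note vc = velocity_chart(3,4)[OF A c(1) nb[OF \<open>t \<in> I\<close>] \<open>t \<in> I\<close> c(2) near[OF x] D[OF this] chd[OF x]]
    show "((\<lambda>r. snd d (\<gamma> r (cis x))) has_vector_derivative ?v x d) (at t within I)"
      "?v x d = frechet_derivative (transition c d) (at (snd c (\<gamma> t (cis x)))) (?v x c)"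
      using vc by simp_all
  qed
  \<comment> \<open>The velocity is continuous along the arc in chart \<open>c\<close> by Sobolev
    regularity; the continuous differential of the transition map carries this over to
    \<open>d\<close>.\<close>
  have v_cont: "continuous_on {\<alpha>..\<beta>} (\<lambda>x. ?v x d)"
  proof -
    have "continuous_on {\<alpha>..\<beta>}
        (\<lambda>x. frechet_derivative (transition c d) (at (snd c (\<gamma> t (cis x)))) (?v x c))"
    proof (rule holomorphic_map_on_frechet_continuous_along)
      show "holomorphic_map_on (transition c d) (snd c ` (fst c \<inter> fst d))"
        "open (snd c ` (fst c \<inter> fst d))"
        using complex_atlas_chart(6,7)[OF A c(1) d(1)] .
      show "continuous_on {\<alpha>..\<beta>} (\<lambda>x. snd c (\<gamma> t (cis x)))" "continuous_on {\<alpha>..\<beta>} (\<lambda>x. ?v x c)"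
        using sob sobv continuous_on_subset[OF _ \<alpha>\<beta>(3)] unfolding sobolev_def by blast+
      show "(\<lambda>x. snd c (\<gamma> t (cis x))) ` {\<alpha>..\<beta>} \<subseteq> snd c ` (fst c \<inter> fst d)"
        using cd by blast
    qed
    then show ?thesis by (rule continuous_on_eq) (rule vd[symmetric])
  qed
  have \<xi>_cont: "continuous_on {a'..b'} (\<lambda>x. \<xi> (cis x) d)"
  proof -
    have "sobolev k a' b' (\<lambda>x. 1 *\<^sub>R \<xi> (cis x) d)"
      using D' unfolding sobolev_has_derivative_def by blast
    then show ?thesis by (simp add: sobolev_def)
  qed
  have "at t within ?S = at t within I"
    by (rule at_within_nhd[of _ "ball t \<delta>'"]) (use tS in auto)
  then have "t islimpt ?S" using nb[OF \<open>t \<in> I\<close>] by (metis trivial_limit_within)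
  \<comment> \<open>Fatou's lemma is about sequences, so the limit at \<open>t\<close> is tested
    along one sequence of times.\<close>
  then obtain q where q: "\<And>n. q n \<in> ?S - {t}" "q \<longlonglongrightarrow> t"
    unfolding islimpt_sequential by blast
  have q_filter: "filterlim q (at t within ?S) sequentially"
    using q by (auto simp: filterlim_at)
  have loop: "\<gamma> r \<in> loop_space k A" if "r \<in> I" for r
    using smooth that unfolding loop_smooth_def by blast
  have cont: "continuous_on {a'..b'} (\<lambda>x. snd d (\<gamma> r (cis x)))" if "r \<in> ?S" for r
    using loop_chart_continuous[OF A d(1) loop arc'[OF that]] that by simp
  define Q where "Q = (\<lambda>r x. (snd d (\<gamma> r (cis x)) - snd d (\<gamma> t (cis x))) /\<^sub>R (r - t))"
  have Q_cont: "continuous_on {a'..b'} (Q r)" if "r \<in> ?S" for r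
    unfolding Q_def using that tS by (intro continuous_intros cont)
  let ?N = "\<lambda>r. sobolev_norm k a' b'
    (\<lambda>x. snd d (\<gamma> r (cis x)) - snd d (\<gamma> t (cis x)) - (r - t) *\<^sub>R \<xi> (cis x) d)"
  have "?v \<theta> d = \<xi> (cis \<theta>) d"
  proof (rule L2_limit_eq_pointwise_limit[of \<alpha> \<beta> "\<lambda>n. Q (q n)" "\<lambda>x. ?v x d" "\<lambda>x. \<xi> (cis x) d"])
    show "\<alpha> < \<beta>" "\<theta> \<in> {\<alpha>..\<beta>}" using \<alpha>\<beta> by auto
    show "continuous_on {\<alpha>..\<beta>} (Q (q n))" for n
      using q(1)[of n] by (intro continuous_on_subset[OF Q_cont \<alpha>\<beta>(4)]) simp
    show "continuous_on {\<alpha>..\<beta>} (\<lambda>x. ?v x d)" by (rule v_cont)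
    show "continuous_on {\<alpha>..\<beta>} (\<lambda>x. \<xi> (cis x) d)" by (rule continuous_on_subset[OF \<xi>_cont \<alpha>\<beta>(4)])
    show "(\<lambda>n. Q (q n) x) \<longlonglongrightarrow> ?v x d" if x: "x \<in> {\<alpha>..\<beta>}" for x
    proof -
      have "((\<lambda>r. Q r x) \<longlongrightarrow> ?v x d) (at t within I)"
        unfolding Q_def by (rule has_vector_derivative_difference_quotient[OF Dd[OF x]])
      then show ?thesis
        using filterlim_compose[OF _ q_filter] \<open>at t within ?S = at t within I\<close> by simp
    qed
    \<comment> \<open>Dividing the remainder by \<open>r - t\<close> gives
      \<open>Q r x - \<xi> (cis x) d\<close>. Passing from the short arc to \<open>{a'..b'}\<close>
      only increases the integral, and there the Sobolev norm dominates its \<open>L^2\<close>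
      part.\<close>
    have bound: "(LINT x:{\<alpha>..\<beta>}|lborel. (norm (Q r x - \<xi> (cis x) d))\<^sup>2) \<le> (?N r / norm (r - t))\<^sup>2"
      if r: "r \<in> ?S - {t}" for r
    proof -
      let ?f = "\<lambda>x. snd d (\<gamma> r (cis x)) - snd d (\<gamma> t (cis x)) - (r - t) *\<^sub>R \<xi> (cis x) d"
      have int: "set_integrable lborel {a'..b'} (\<lambda>x. (norm (Q r x - \<xi> (cis x) d))\<^sup>2)"
        using r by (intro borel_integrable_atLeastAtMost' continuous_intros \<xi>_cont Q_cont) simp
      have "(LINT x:{\<alpha>..\<beta>}|lborel. (norm (Q r x - \<xi> (cis x) d))\<^sup>2) \<le>
          (LINT x:{a'..b'}|lborel. (norm (Q r x - \<xi> (cis x) d))\<^sup>2)"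
        unfolding set_lebesgue_integral_def
      proof (rule Bochner_Integration.integral_mono)
        show "integrable lborel (\<lambda>x. indicat_real {\<alpha>..\<beta>} x *\<^sub>R (norm (Q r x - \<xi> (cis x) d))\<^sup>2)"
          using set_integrable_subset[OF int _ \<alpha>\<beta>(4)] unfolding set_integrable_def by simp
        show "integrable lborel (\<lambda>x. indicat_real {a'..b'} x *\<^sub>R (norm (Q r x - \<xi> (cis x) d))\<^sup>2)"
          using int unfolding set_integrable_def .
        show "indicat_real {\<alpha>..\<beta>} x *\<^sub>R (norm (Q r x - \<xi> (cis x) d))\<^sup>2
            \<le> indicat_real {a'..b'} x *\<^sub>R (norm (Q r x - \<xi> (cis x) d))\<^sup>2" for x
          using \<alpha>\<beta>(4) by (intro scaleR_right_mono) (auto simp: indicator_def subset_iff)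
      qed
      also have "\<dots> = (LINT x:{a'..b'}|lborel. (norm (?f x))\<^sup>2 / (norm (r - t))\<^sup>2)"
      proof -
        have "Q r x - \<xi> (cis x) d = ?f x /\<^sub>R (r - t)" for x
          using r by (simp add: Q_def scaleR_diff_right)
        then have "(norm (Q r x - \<xi> (cis x) d))\<^sup>2 = (norm (?f x))\<^sup>2 / (norm (r - t))\<^sup>2" for x
          by (simp add: power_mult_distrib power_inverse divide_inverse mult.commute)
        then show ?thesis by simp
      qed
      also have "\<dots> = (LINT x:{a'..b'}|lborel. (norm (?f x))\<^sup>2) / (norm (r - t))\<^sup>2"
        by (rule set_integral_divide_zero)
      also have "\<dots> \<le> (?N r)\<^sup>2 / (norm (r - t))\<^sup>2"
        by (intro divide_right_mono L2_le_sobolev_norm) simp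
      finally show ?thesis by (simp add: power_divide)
    qed
    have "((\<lambda>r. ?N r / norm (r - t)) \<longlongrightarrow> 0) (at t within ?S)"
      using D' unfolding sobolev_has_derivative_def by blast
    from filterlim_compose[OF this q_filter]
    have "(\<lambda>n. (?N (q n) / norm (q n - t))\<^sup>2) \<longlonglongrightarrow> 0\<^sup>2"
      by (rule tendsto_power)
    then have lim: "(\<lambda>n. (?N (q n) / norm (q n - t))\<^sup>2) \<longlonglongrightarrow> 0" by simp
    show "(\<lambda>n. LINT x:{\<alpha>..\<beta>}|lborel. (norm (Q (q n) x - \<xi> (cis x) d))\<^sup>2) \<longlonglongrightarrow> 0"
    proof (rule Lim_null_comparison[OF always_eventually lim], rule allI)
      fix n
      show "norm (LINT x:{\<alpha>..\<beta>}|lborel. (norm (Q (q n) x - \<xi> (cis x) d))\<^sup>2) \<le> (?N (q n) / norm (q n - t))\<^sup>2"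
        using bound[OF q(1)[of n]] unfolding real_norm_def[of "set_lebesgue_integral _ _ _"]
          abs_of_nonneg[OF set_integral_power2_norm_nonneg] .
    qed
  qed
  moreover have "chart_at A (\<gamma> t (cis \<theta>)) d" using chd[of \<theta>] \<alpha>\<beta> by simp
  ultimately show "\<exists>c. chart_at A (\<gamma> t (cis \<theta>)) c \<and>
      \<xi> (cis \<theta>) c = pointwise_velocity A I \<gamma> t (cis \<theta>) c"
    by (intro exI[of _ d]) simp
qed

lemma loop_velocity_eq:
  fixes A :: "('x::{t2_space, second_countable_topology}, 'n::finite) chart set"
  assumes "complex_atlas A" "k \<ge> 1" "\<And>t. t \<in> I \<Longrightarrow> at t within I \<noteq> bot"
    and "loop_smooth (Suc m) k A I \<gamma>" "t \<in> I"
  shows "loop_velocity k A I \<gamma> t = pointwise_velocity A I \<gamma> t"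
  unfolding loop_velocity_def
  using has_loop_velocity_pointwise_velocity[OF assms] has_loop_velocity_unique[OF assms]
  by (rule the_equality)

section \<open>Reduction of the geodesic equation to the points of the circle\<close>

lemma loop_smooth_Suc_imp:
  assumes "loop_smooth (Suc m) k A (I :: real set) \<gamma>"
  shows "loop_smooth m k A I \<gamma>"
  unfolding loop_smooth_def
proof (intro conjI ballI allI)
  show "\<gamma> p \<in> loop_space k A" if "p \<in> I" for p
    using assms that unfolding loop_smooth_def by blast
  fix p \<theta> assume "p \<in> I"
  then obtain c a b \<delta> where "c \<in> A" "\<delta> > 0" "a < \<theta>" "\<theta> < b"
    "\<forall>q\<in>I \<inter> ball p \<delta>. arc_in_chart c a b (\<gamma> q)"
    "sobolev_Ck (Suc m) k a b (\<lambda>q x. snd c (\<gamma> q (cis x))) (I \<inter> ball p \<delta>)"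
    using assms unfolding loop_smooth_def by metis
  then show "\<exists>c\<in>A. \<exists>a b. \<exists>\<delta>>0. a < \<theta> \<and> \<theta> < b \<and>
        (\<forall>q\<in>I \<inter> ball p \<delta>. arc_in_chart c a b (\<gamma> q)) \<and>
        sobolev_Ck m k a b (\<lambda>q x. snd c (\<gamma> q (cis x))) (I \<inter> ball p \<delta>)"
    using sobolev_Ck_Suc_imp by blast
qed

lemma loop_smooth_imp_smooth_curve:
  fixes \<gamma> :: "real \<Rightarrow> complex \<Rightarrow> 'x::topological_space"
  assumes "loop_smooth m k A I \<gamma>" "k \<ge> 1" "s \<in> S1"
  shows "smooth_curve m A I (\<lambda>t. \<gamma> t s)"
  unfolding smooth_curve_def
proof
  fix t assume "t \<in> I"
  obtain \<theta> where s: "s = cis \<theta>" using \<open>s \<in> S1\<close> by (rule sphere_cis_cases)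
  obtain c a b \<delta> where c: "c \<in> A" "\<delta> > 0" "a < \<theta>" "\<theta> < b"
    and arc: "\<forall>q\<in>I \<inter> ball t \<delta>. arc_in_chart c a b (\<gamma> q)"
    and Ck: "sobolev_Ck m k a b (\<lambda>q x. snd c (\<gamma> q (cis x))) (I \<inter> ball t \<delta>)"
    using assms(1) \<open>t \<in> I\<close> unfolding loop_smooth_def by metis
  have "curve_Ck m (\<lambda>r. snd c (\<gamma> r (cis \<theta>))) (I \<inter> ball t \<delta>)"
    by (rule sobolev_Ck_imp_curve_Ck[OF _ \<open>k \<ge> 1\<close> _ Ck]) (use c in auto)
  moreover have "\<forall>r\<in>I \<inter> ball t \<delta>. \<gamma> r (cis \<theta>) \<in> fst c"
    using arc c by (auto simp: arc_in_chart_def)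
  ultimately show "\<exists>c\<in>A. \<exists>\<delta>>0. (\<forall>r\<in>I \<inter> ball t \<delta>. \<gamma> r s \<in> fst c) \<and>
      curve_Ck m (\<lambda>r. snd c (\<gamma> r s)) (I \<inter> ball t \<delta>)"
    using c s by blast
qed

text \<open>\<open>loop_velocity\<close> is identified with the pointwise velocity only at times in
  \<open>I\<close>; this congruence and the one for covariant derivatives make that
  sufficient.\<close>

lemma loop_field_cong:
  assumes "\<And>t. t \<in> I \<Longrightarrow> \<xi> t = \<eta> t"
  shows "loop_field m k A I \<gamma> \<xi> \<longleftrightarrow> loop_field m k A I \<gamma> \<eta>"
proof -
  have "sobolev_Ck m k a b (\<lambda>r x. \<xi> r (cis x) c) (I \<inter> ball t \<delta>) \<longleftrightarrow>
      sobolev_Ck m k a b (\<lambda>r x. \<eta> r (cis x) c) (I \<inter> ball t \<delta>)" for a b c t \<delta>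
    by (rule sobolev_Ck_cong) (simp add: assms)
  then show ?thesis using assms unfolding loop_field_def by simp
qed

lemma covariant_derivative_cong:
  assumes "\<And>r. r \<in> I \<Longrightarrow> V r = W r" "t \<in> I"
  shows "covariant_derivative A \<Gamma> I \<gamma> V t = covariant_derivative A \<Gamma> I \<gamma> W t"
proof -
  have "((\<lambda>r. V r c) has_vector_derivative D) (at t within I) \<longleftrightarrow>
      ((\<lambda>r. W r c) has_vector_derivative D) (at t within I)" for c D
    by (rule has_vector_derivative_cong_ev) (auto simp: assms)
  then show ?thesis
    using assms by (auto simp: covariant_derivative_def vector_derivative_def fun_eq_iff)
qed

text \<open>On the circle the realization formula applies once the velocity is known to be a
  \<open>C^1\<close> field. Off the circle it says nothing, and the value 0 comes from
  \<open>N\<close> mapping into \<open>tangent_loops\<close>.\<close>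

lemma realized_by_loop_velocity:
  fixes A :: "('x::{t2_space, second_countable_topology}, 'n::finite) chart set"
  assumes A: "complex_atlas A" "k \<ge> 1" and I: "nondegenerate_interval I"
    and nb: "\<And>t. t \<in> I \<Longrightarrow> at t within I \<noteq> bot"
    and smooth: "loop_smooth 2 k A I \<gamma>"
    and N: "loop_covariant_derivative k A N" "realized_by k A \<Gamma> N" and "t \<in> I"
  shows "N I \<gamma> (loop_velocity k A I \<gamma>) t s = (if s \<in> S1
    then covariant_derivative A \<Gamma> I (\<lambda>r. \<gamma> r s) (velocity A I (\<lambda>r. \<gamma> r s)) t else (\<lambda>c. 0))"
proof -
  have smooth2: "loop_smooth (Suc 1) k A I \<gamma>" using smooth by (simp add: numeral_2_eq_2)
  then have smooth1: "loop_smooth 1 k A I \<gamma>" by (rule loop_smooth_Suc_imp)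
  note vel = loop_velocity_eq[OF A nb smooth2]
  have field: "loop_field 1 k A I \<gamma> (loop_velocity k A I \<gamma>)"
    using loop_field_pointwise_velocity[OF A nb smooth2] loop_field_cong[OF vel] by simp
  show ?thesis
  proof (cases "s \<in> S1")
    case True
    have "N I \<gamma> (loop_velocity k A I \<gamma>) t s =
        covariant_derivative A \<Gamma> I (\<lambda>r. \<gamma> r s) (\<lambda>r. loop_velocity k A I \<gamma> r s) t"
      using N(2) I smooth1 field \<open>t \<in> I\<close> True unfolding realized_by_def by blast
    also have "\<dots> = covariant_derivative A \<Gamma> I (\<lambda>r. \<gamma> r s) (velocity A I (\<lambda>r. \<gamma> r s)) t"
      using vel True \<open>t \<in> I\<close> by (intro covariant_derivative_cong) (simp_all add: pointwise_velocity_def)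
    finally show ?thesis using True by simp
  next
    case False
    have "N I \<gamma> (loop_velocity k A I \<gamma>) t \<in> tangent_loops k A (\<gamma> t)"
      using N(1) I smooth1 field \<open>t \<in> I\<close> unfolding loop_covariant_derivative_def by blast
    then show ?thesis using False unfolding tangent_loops_def by auto
  qed
qed

theorem mainTheorem5:
  fixes A :: "('x::{t2_space, second_countable_topology}, 'n::finite) chart set"
    and h :: "('x, 'n) tmetric"
    and \<Gamma> :: "('x, 'n) christoffel"
    and k :: nat
    and ds :: "complex measure"
    and N :: "('x, 'n) loop_connection"
    and f g :: "complex \<Rightarrow> 'x"
    and \<gamma> :: "real \<Rightarrow> complex \<Rightarrow> 'x"
  assumes "kaehler_manifold A h"
    and "levi_civita A h \<Gamma>"
    and "k \<ge> 1"
    and "rotation_invariant ds"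
    and "loop_levi_civita k A (loop_metric h ds) N"
    and "realized_by k A \<Gamma> N"
    and "f \<in> loop_space k A" and "g \<in> loop_space k A"
    and "loop_smooth 2 k A {0..1} \<gamma>"
    and "\<forall>s\<in>S1. \<gamma> 0 s = f s \<and> \<gamma> 1 s = g s"
  shows "loop_geodesic k A N {0..1} \<gamma> \<longleftrightarrow>
    (\<forall>s\<in>S1. geodesic A \<Gamma> {0..1} (\<lambda>t. \<gamma> t s) \<and> \<gamma> 0 s = f s \<and> \<gamma> 1 s = g s)"
proof -
  have A: "complex_atlas A" using assms(1) by (simp add: kaehler_manifold_def)
  have I: "nondegenerate_interval {0..1}"
    unfolding nondegenerate_interval_def
  proof
    show "\<exists>a\<in>{0..1::real}. \<exists>b\<in>{0..1}. a < b"
      by (rule bexI[of _ 0], rule bexI[of _ 1]) auto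
  qed (rule is_interval_cc)
  \<comment> \<open>The endpoints are limit points of the interval as well, so one-sided derivatives
    there are unique.\<close>
  have nb: "at t within {0..1} \<noteq> bot" if "t \<in> {0..1}" for t :: real
    using that by (simp add: trivial_limit_within)
  \<comment> \<open>The smoothness conjunct is the assumption on \<open>\<gamma>\<close>, and off
    the circle the equation is automatic; what remains is a condition for each time and each point
    of the circle.\<close>
  have "loop_geodesic k A N {0..1} \<gamma> \<longleftrightarrow> (\<forall>t\<in>{0..1}. \<forall>s\<in>S1. covariant_derivative A \<Gamma> {0..1}
      (\<lambda>r. \<gamma> r s) (velocity A {0..1} (\<lambda>r. \<gamma> r s)) t = (\<lambda>c. 0))"
    using assms(9) realized_by_loop_velocity[OF A assms(3) I nb assms(9) _ assms(6)] assms(5)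
    unfolding loop_geodesic_def loop_levi_civita_def fun_eq_iff by (auto split: if_splits)
  also have "\<dots> \<longleftrightarrow> (\<forall>s\<in>S1. geodesic A \<Gamma> {0..1} (\<lambda>t. \<gamma> t s))"
    \<comment> \<open>The quantifiers over times and points are exchanged; evaluation at a point
      preserves the class \<open>C^2\<close>, which supplies the smoothness part of
      \<open>geodesic\<close>.\<close>
    using loop_smooth_imp_smooth_curve[OF assms(9,3)] unfolding geodesic_def by blast
  finally show ?thesis using assms(10) by blast
qed

end
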